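(* Let $n\ge 1$ and let $K$ be the Markov chain on $\mathrm{Irr}(S_n)$ defined from the $n$-dimensional defining representation $\eta$ of $S_n$. Let $s(r)=\max_{\lambda\in \mathrm{Irr}(S_n)}\left[1-\frac{K^r(\hat 1,\lambda)}{\pi(\lambda)}\right]$ be the separation distance between the distribution of $K$ after $r$ steps started at the trivial representation $\hat 1$ and the Plancherel measure $\pi$. (1) For every integer $r\ge 0$, $$ s(r) = \sum_{i=0}^{n-2} (-1)^{n-i} \binom{n}{i} (n-i-1) \left( \frac{i}{n} \right)^r .$$ (2) For $c$ fixed in $\mathbb{R}$ and $n\to\infty$, $$ s(n\log(n)+cn) = 1-e^{-e^{-c}}(1+e^{-c}) + O\left(\frac{\log(n)}{n}\right),$$ where the number of steps $n\log(n)+cn$ is understood as rounded down to an integer.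
   Context: All representations are finite-dimensional complex representations. For a finite group $G$, $\mathrm{Irr}(G)$ is the set of (isomorphism classes of) irreducible representations, $d_\lambda$ is the dimension of $\lambda$, and $m_\rho(V)$ is the multiplicity of the irreducible $\rho$ in the representation $V$. Given a representation $\eta$ of $G$ with real-valued character, the associated Markov chain on $\mathrm{Irr}(G)$ has transition probabilities $$K(\lambda,\rho)=\frac{d_\rho\, m_\rho(\lambda\otimes\eta)}{d_\lambda d_\eta},$$ and $K^r(\lambda,\rho)$ denotes the $r$-step transition probability. It is reversible with respect to the Plancherel measure $\pi(\lambda)=d_\lambda^2/|G|$. The trivial representation is denoted $\hat 1$. Here $G=S_n$ and $\eta$ is the $n$-dimensional defining (permutation) representation, whose character at $g$ is the number of fixed points of $g$. The convention $0^0=1$ is used; $\log$ is the natural logarithm; the constant implied by $O(\cdot)$ may depend on $c$. *)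

theory Defs
  imports
    "Jordan_Normal_Form.VS_Connect"
    "HOL-Algebra.Sym_Groups"
    "HOL-Library.Landau_Symbols"
begin

text \<open>A finite-dimensional complex representation is taken in coordinates: it is a homomorphism
  from the group into the invertible complex matrices of some size \<open>d\<close>, where \<open>d = 0\<close> is allowed.
  Up to isomorphism this covers all of them. Invertibility of each \<open>\<rho> g\<close> follows from the laws.
  Values outside the carrier of the group are irrelevant.\<close>

type_synonym 'g rep = "'g \<Rightarrow> complex mat"

definition rep_dim :: "('g, 'm) monoid_scheme \<Rightarrow> 'g rep \<Rightarrow> nat" where
  "rep_dim G \<rho> = dim_row (\<rho> \<one>\<^bsub>G\<^esub>)"

definition representation :: "('g, 'm) monoid_scheme \<Rightarrow> 'g rep \<Rightarrow> bool" where
  "representation G \<rho> \<longleftrightarrow>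
     (\<forall>g\<in>carrier G. \<rho> g \<in> carrier_mat (rep_dim G \<rho>) (rep_dim G \<rho>)) \<and>
     \<rho> \<one>\<^bsub>G\<^esub> = 1\<^sub>m (rep_dim G \<rho>) \<and>
     (\<forall>g\<in>carrier G. \<forall>h\<in>carrier G. \<rho> (g \<otimes>\<^bsub>G\<^esub> h) = \<rho> g * \<rho> h)"

definition rep_iso :: "('g, 'm) monoid_scheme \<Rightarrow> 'g rep \<Rightarrow> 'g rep \<Rightarrow> bool" where
  "rep_iso G \<rho> \<sigma> \<longleftrightarrow>
     (\<exists>T \<in> carrier_mat (rep_dim G \<sigma>) (rep_dim G \<rho>).
        invertible_mat T \<and> (\<forall>g\<in>carrier G. T * \<rho> g = \<sigma> g * T))"

definition irreducible_rep :: "('g, 'm) monoid_scheme \<Rightarrow> 'g rep \<Rightarrow> bool" where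
  "irreducible_rep G \<rho> \<longleftrightarrow>
     representation G \<rho> \<and> rep_dim G \<rho> > 0 \<and>
     (\<forall>W. VectorSpace.subspace class_ring W (module_vec TYPE(complex) (rep_dim G \<rho>)) \<and>
          (\<forall>g\<in>carrier G. \<forall>w\<in>W. \<rho> g *\<^sub>v w \<in> W)
        \<longrightarrow> W = {0\<^sub>v (rep_dim G \<rho>)} \<or> W = carrier_vec (rep_dim G \<rho>))"

definition kronecker :: "complex mat \<Rightarrow> complex mat \<Rightarrow> complex mat" where
  "kronecker A B = mat (dim_row A * dim_row B) (dim_col A * dim_col B)
     (\<lambda>(i, j). A $$ (i div dim_row B, j div dim_col B) * B $$ (i mod dim_row B, j mod dim_col B))"

definition tensor_rep :: "'g rep \<Rightarrow> 'g rep \<Rightarrow> 'g rep" where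
  "tensor_rep \<rho> \<sigma> = (\<lambda>g. kronecker (\<rho> g) (\<sigma> g))"

definition direct_sum_rep :: "'g rep list \<Rightarrow> 'g rep" where
  "direct_sum_rep \<sigma>s = (\<lambda>g. diag_block_mat (map (\<lambda>\<sigma>. \<sigma> g) \<sigma>s))"

text \<open>The number of summands isomorphic to \<open>\<rho>\<close> in a decomposition of \<open>V\<close> into irreducibles. For
  finite groups a decomposition exists and this number does not depend on it.\<close>

definition multiplicity_rep :: "('g, 'm) monoid_scheme \<Rightarrow> 'g rep \<Rightarrow> 'g rep \<Rightarrow> nat" where
  "multiplicity_rep G \<rho> V =
     (THE m. \<exists>\<sigma>s. (\<forall>\<sigma>\<in>set \<sigma>s. irreducible_rep G \<sigma>) \<and> rep_iso G V (direct_sum_rep \<sigma>s) \<and>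
                  m = length (filter (\<lambda>\<sigma>. rep_iso G \<rho> \<sigma>) \<sigma>s))"

definition irr_iso_rel :: "('g, 'm) monoid_scheme \<Rightarrow> ('g rep \<times> 'g rep) set" where
  "irr_iso_rel G = {(\<rho>, \<sigma>). irreducible_rep G \<rho> \<and> irreducible_rep G \<sigma> \<and> rep_iso G \<rho> \<sigma>}"

definition Irr :: "('g, 'm) monoid_scheme \<Rightarrow> 'g rep set set" where
  "Irr G = {\<rho>. irreducible_rep G \<rho>} // irr_iso_rel G"

text \<open>Dimension and multiplicity are invariant under isomorphism, so on isomorphism classes they are
  computed on an arbitrary representative.\<close>

definition representative :: "'g rep set \<Rightarrow> 'g rep" where
  "representative \<alpha> = (SOME \<rho>. \<rho> \<in> \<alpha>)"

definition irr_dim :: "('g, 'm) monoid_scheme \<Rightarrow> 'g rep set \<Rightarrow> nat" where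
  "irr_dim G \<alpha> = rep_dim G (representative \<alpha>)"

definition trivial_irr :: "('g, 'm) monoid_scheme \<Rightarrow> 'g rep set" where
  "trivial_irr G = irr_iso_rel G `` {\<lambda>g. 1\<^sub>m 1}"

definition plancherel :: "('g, 'm) monoid_scheme \<Rightarrow> 'g rep set \<Rightarrow> real" where
  "plancherel G \<alpha> = (real (irr_dim G \<alpha>))\<^sup>2 / real (card (carrier G))"

definition irr_kernel ::
  "('g, 'm) monoid_scheme \<Rightarrow> 'g rep \<Rightarrow> 'g rep set \<Rightarrow> 'g rep set \<Rightarrow> real" where
  "irr_kernel G \<eta> \<alpha> \<beta> =
     real (irr_dim G \<beta>)
       * real (multiplicity_rep G (representative \<beta>) (tensor_rep (representative \<alpha>) \<eta>))
     / (real (irr_dim G \<alpha>) * real (rep_dim G \<eta>))"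

primrec kernel_power :: "'s set \<Rightarrow> ('s \<Rightarrow> 's \<Rightarrow> real) \<Rightarrow> nat \<Rightarrow> 's \<Rightarrow> 's \<Rightarrow> real" where
  "kernel_power S K 0 x y = (if x = y then 1 else 0)"
| "kernel_power S K (Suc r) x y = (\<Sum>z\<in>S. kernel_power S K r x z * K z y)"

text \<open>The library's symmetric group permutes \<open>{1..n}\<close>, while matrix indices start at \<open>0\<close>: row and
  column \<open>i\<close> belong to the point \<open>Suc i\<close>, and \<open>p\<close> maps the basis vector of \<open>k\<close> to that of \<open>p k\<close>.\<close>

definition defining_rep :: "nat \<Rightarrow> (nat \<Rightarrow> nat) rep" where
  "defining_rep n = (\<lambda>p. mat n n (\<lambda>(i, j). if Suc i = p (Suc j) then 1 else 0))"

definition separation_distance :: "'s set \<Rightarrow> ('s \<Rightarrow> real) \<Rightarrow> ('s \<Rightarrow> real) \<Rightarrow> real" where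
  "separation_distance S \<mu> \<pi> = Max ((\<lambda>x. 1 - \<mu> x / \<pi> x) ` S)"

definition sym_separation :: "nat \<Rightarrow> nat \<Rightarrow> real" where
  "sym_separation n r =
     (let G = sym_group n in
      separation_distance (Irr G)
        (kernel_power (Irr G) (irr_kernel G (defining_rep n)) r (trivial_irr G))
        (plancherel G))"

end

theory Submission
  imports Defs "Jordan_Normal_Form.Spectral_Radius"
begin

text \<open>
Write \<open>\<eta>\<close> for the defining representation, \<open>\<chi>\<close> and \<open>d\<close> for the character and the dimension of an
irreducible representation \<open>\<lambda>\<close>, and \<open>m\<close> for the multiplicity of \<open>\<lambda>\<close> in the tensor power of \<open>\<eta>\<close> with
\<open>r\<close> factors. A step of the chain tensors with \<open>\<eta>\<close>, so after \<open>r\<close> steps from the trivial representation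
the chain is at \<open>\<lambda>\<close> with probability \<open>d * m / n ^ r\<close> (\<open>kernel_power_from_trivial\<close>). Divided by the
Plancherel weight this is \<open>n! * m / (d * n ^ r)\<close>, and the separation distance asks for its minimum
over \<open>\<lambda>\<close>.

The tensor power permutes the words of length \<open>r\<close> over the letters \<open>1, ..., n\<close>, and a permutation fixes
a word exactly if it moves only letters that do not occur in the word. Interchanging the summations
over permutations and words turns \<open>n! * m\<close> into a sum over the words \<open>w\<close> of the sums of \<open>\<chi>\<close> over the
symmetric groups on the letters missing from \<open>w\<close> (\<open>multiplicity_words\<close>). The sum of a character over a
subgroup is a natural number, because up to the order of the subgroup it is the multiplicity of the
trivial representation in the restriction. If at most one letter is missing, then the subgroup is
trivial and the sum is \<open>d\<close>. Hence \<open>n! * m / d\<close> is at least the number of words that miss at most one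
letter (\<open>multiplicity_lower_bound\<close>). For the sign representation all other words contribute \<open>0\<close>, since
even and odd permutations cancel; so the sign representation attains the minimum
(\<open>multiplicity_sign\<close>). The separation distance is therefore the probability that \<open>r\<close> random
draws from \<open>n\<close> coupons leave at least two coupons undrawn (\<open>sym_separation_words\<close>), and the first
formula is inclusion and exclusion over the set of undrawn coupons (\<open>coupon_formula_words\<close>).

For the second formula, the terms \<open>(n choose j) * (1 - j / n) ^ r\<close> of that sum are close to
\<open>y ^ j / j!\<close> with \<open>y = n * exp (- r / n)\<close>, with a relative error of at most \<open>j\<^sup>2 * (1 / n + r / n\<^sup>2)\<close>
(\<open>binomial_term_bounds\<close>). The resulting exponential series sums to \<open>1 - (y + 1) * exp (- y)\<close>, and for
\<open>r\<close> near \<open>n * ln n + c * n\<close> one has \<open>y\<close> within \<open>O(1 / n)\<close> of \<open>exp (- c)\<close> while the relative error has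
order \<open>ln n / n\<close>.

Multiplicities enter only through characters. For a finite group, Maschke's theorem, Schur's lemma
and the orthogonality of irreducible characters identify the multiplicity with an inner product of
characters (\<open>multiplicity_char_inner\<close>). That the symmetric group has only finitely many irreducible
representations, without which the sums and the maximum over \<open>Irr\<close> would be meaningless, follows
from the lower bound above: for \<open>r = n\<close> it is positive, so every irreducible representation occurs in
one and the same tensor power.
\<close>

section \<open>Traces and sums of matrices\<close>

lemma mult_mat_entry:
  assumes "A \<in> carrier_mat n m" "B \<in> carrier_mat m p" "i < n" "j < p"
  shows "(A * B) $$ (i, j) = (\<Sum>k<m. A $$ (i, k) * B $$ (k, j))"
  using assms by (auto simp: scalar_prod_def lessThan_atLeast0 intro!: sum.cong)

definition mtrace :: "'a::comm_monoid_add mat \<Rightarrow> 'a" where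
  "mtrace A = (\<Sum>i<dim_row A. A $$ (i, i))"

text \<open>Besides making characters invariant under isomorphism, this compares dimensions: matrices that are
inverse to each other on both sides are square, because both products have the same trace.\<close>

lemma mtrace_mult_commute:
  fixes A B :: "'a::comm_semiring_0 mat"
  assumes "A \<in> carrier_mat n m" "B \<in> carrier_mat m n"
  shows "mtrace (A * B) = mtrace (B * A)"
proof -
  have "mtrace (A * B) = (\<Sum>i<n. \<Sum>k<m. A $$ (i, k) * B $$ (k, i))"
    using assms by (auto simp: mtrace_def mult_mat_entry[OF assms] simp del: index_mult_mat(1) intro!: sum.cong)
  also have "\<dots> = (\<Sum>k<m. \<Sum>i<n. B $$ (k, i) * A $$ (i, k))"
    by (subst sum.swap) (simp add: mult.commute)
  also have "\<dots> = mtrace (B * A)"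
    using assms by (auto simp: mtrace_def mult_mat_entry[OF assms(2,1)] simp del: index_mult_mat(1) intro!: sum.cong)
  finally show ?thesis .
qed

lemma mtrace_one [simp]: "mtrace (1\<^sub>m n :: 'a::semiring_1 mat) = of_nat n"
  by (simp add: mtrace_def)

lemma mtrace_smult: "mtrace (c \<cdot>\<^sub>m A) = c * mtrace (A :: 'a::comm_semiring_0 mat)"
  if "A \<in> carrier_mat n n"
  using that by (simp add: mtrace_def sum_distrib_left)

lemma mtrace_conjugate:
  fixes A :: "'a::comm_semiring_1 mat"
  assumes "A \<in> carrier_mat n n" "S \<in> carrier_mat m n" "S' \<in> carrier_mat n m" "S' * S = 1\<^sub>m n"
  shows "mtrace (S * A * S') = mtrace A"
proof -
  have "mtrace (S * A * S') = mtrace (S' * (S * A))"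
    by (rule mtrace_mult_commute[where n=m and m=n]) (use assms in auto)
  also have "S' * (S * A) = (S' * S) * A"
    by (rule assoc_mult_mat[symmetric]) (use assms in auto)
  also have "\<dots> = A" using assms by simp
  finally show ?thesis .
qed

text \<open>The carrier of matrices of a fixed size is not a type, so sums of matrices over a group are taken
entry by entry in a prescribed size.\<close>

definition mat_sum :: "nat \<Rightarrow> nat \<Rightarrow> ('i \<Rightarrow> 'a::comm_monoid_add mat) \<Rightarrow> 'i set \<Rightarrow> 'a mat" where
  "mat_sum n m F I = mat n m (\<lambda>ij. \<Sum>g\<in>I. F g $$ ij)"

lemma mat_sum_carrier [simp]: "mat_sum n m F I \<in> carrier_mat n m"
  by (simp add: mat_sum_def)

lemma mat_sum_index [simp]:
  "i < n \<Longrightarrow> j < m \<Longrightarrow> mat_sum n m F I $$ (i, j) = (\<Sum>g\<in>I. F g $$ (i, j))"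
  by (simp add: mat_sum_def)

lemma mat_sum_dim [simp]: "dim_row (mat_sum n m F I) = n" "dim_col (mat_sum n m F I) = m"
  by (simp_all add: mat_sum_def)

lemma mult_mat_sum:
  fixes A :: "'a::semiring_0 mat"
  assumes "A \<in> carrier_mat p n" "\<And>g. g \<in> I \<Longrightarrow> F g \<in> carrier_mat n m"
  shows "A * mat_sum n m F I = mat_sum p m (\<lambda>g. A * F g) I"
proof (rule eq_matI)
  fix i j assume ij: "i < dim_row (mat_sum p m (\<lambda>g. A * F g) I)" "j < dim_col (mat_sum p m (\<lambda>g. A * F g) I)"
  then have "(A * mat_sum n m F I) $$ (i, j) = (\<Sum>k<n. A $$ (i, k) * (\<Sum>g\<in>I. F g $$ (k, j)))"
    by (subst mult_mat_entry[OF assms(1) mat_sum_carrier]) auto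
  also have "\<dots> = (\<Sum>g\<in>I. \<Sum>k<n. A $$ (i, k) * F g $$ (k, j))"
    by (simp add: sum_distrib_left) (rule sum.swap)
  also have "\<dots> = (\<Sum>g\<in>I. (A * F g) $$ (i, j))"
    by (rule sum.cong[OF refl], rule mult_mat_entry[symmetric, OF assms(1) assms(2)]) (use ij in auto)
  finally show "(A * mat_sum n m F I) $$ (i, j) = mat_sum p m (\<lambda>g. A * F g) I $$ (i, j)"
    using ij by simp
qed (use assms in auto)

lemma mat_sum_mult:
  fixes A :: "'a::semiring_0 mat"
  assumes "A \<in> carrier_mat m p" "\<And>g. g \<in> I \<Longrightarrow> F g \<in> carrier_mat n m"
  shows "mat_sum n m F I * A = mat_sum n p (\<lambda>g. F g * A) I"
proof (rule eq_matI)
  fix i j assume ij: "i < dim_row (mat_sum n p (\<lambda>g. F g * A) I)" "j < dim_col (mat_sum n p (\<lambda>g. F g * A) I)"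
  then have "(mat_sum n m F I * A) $$ (i, j) = (\<Sum>k<m. (\<Sum>g\<in>I. F g $$ (i, k)) * A $$ (k, j))"
    by (subst mult_mat_entry[OF mat_sum_carrier assms(1)]) auto
  also have "\<dots> = (\<Sum>g\<in>I. \<Sum>k<m. F g $$ (i, k) * A $$ (k, j))"
    by (simp add: sum_distrib_right) (rule sum.swap)
  also have "\<dots> = (\<Sum>g\<in>I. (F g * A) $$ (i, j))"
    by (rule sum.cong[OF refl], rule mult_mat_entry[symmetric, OF assms(2) assms(1)]) (use ij in auto)
  finally show "(mat_sum n m F I * A) $$ (i, j) = mat_sum n p (\<lambda>g. F g * A) I $$ (i, j)"
    using ij by simp
qed (use assms in auto)

lemma mat_sum_cong:
  "(\<And>g. g \<in> I \<Longrightarrow> F g = H g) \<Longrightarrow> mat_sum n m F I = mat_sum n m H I"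
  by (auto simp: mat_sum_def intro!: eq_matI sum.cong)


section \<open>Invariant subspaces and adapted bases\<close>

lemma subspace_vecI:
  assumes "W \<subseteq> carrier_vec n" "0\<^sub>v n \<in> W"
    and "\<And>v w. v \<in> W \<Longrightarrow> w \<in> W \<Longrightarrow> v + w \<in> W" "\<And>a v. v \<in> W \<Longrightarrow> a \<cdot>\<^sub>v v \<in> W"
  shows "VectorSpace.subspace class_ring W (module_vec TYPE(complex) n)"
proof -
  interpret vec_space "TYPE(complex)" n .
  show ?thesis
    by (intro VectorSpace.subspace.intro submodule.intro vectorspace_axioms module_axioms)
      (use assms in \<open>auto simp: module_vec_simps\<close>)
qed

lemma subspace_vecD:
  assumes "VectorSpace.subspace class_ring W (module_vec TYPE(complex) n)"
  shows "W \<subseteq> carrier_vec n" "0\<^sub>v n \<in> W"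
    and "v \<in> W \<Longrightarrow> w \<in> W \<Longrightarrow> v + w \<in> W" "v \<in> W \<Longrightarrow> a \<cdot>\<^sub>v v \<in> W"
proof -
  interpret VectorSpace.subspace class_ring W "module_vec TYPE(complex) n" by fact
  interpret submodule class_ring W "module_vec TYPE(complex) n" by (rule submod)
  show "W \<subseteq> carrier_vec n" "0\<^sub>v n \<in> W"
    and "v \<in> W \<Longrightarrow> w \<in> W \<Longrightarrow> v + w \<in> W" "v \<in> W \<Longrightarrow> a \<cdot>\<^sub>v v \<in> W"
    using subset zero_closed m_closed[of v w] smult_closed[of a v] by (auto simp: module_vec_simps)
qed

lemma mat_eq_on_vecs:
  fixes A B :: "'a::comm_ring_1 mat"
  assumes "A \<in> carrier_mat n m" "B \<in> carrier_mat n m"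
    and eq: "\<And>v. v \<in> carrier_vec m \<Longrightarrow> A *\<^sub>v v = B *\<^sub>v v"
  shows "A = B"
proof (rule eq_matI)
  fix i j assume "i < dim_row B" "j < dim_col B"
  then have ij: "i < n" "j < m" using assms by auto
  have "(M *\<^sub>v unit_vec m j) $ i = M $$ (i, j)" if "M \<in> carrier_mat n m" for M :: "'a mat"
    using that ij by simp
  from this[OF assms(1)] this[OF assms(2)] show "A $$ (i, j) = B $$ (i, j)" by (simp add: eq)
qed (use assms in auto)

text \<open>The Sherman--Morrison formula, used below to exchange one vector of a basis.\<close>

lemma rank_one_perturbation_inverse:
  fixes v f :: "nat \<Rightarrow> complex"
  assumes s: "1 + (\<Sum>c<n. f c * v c) = s" "s \<noteq> 0"
  defines "E \<equiv> mat n n (\<lambda>(a, b). (if a = b then 1 else 0) + v a * f b)"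
    and "F \<equiv> mat n n (\<lambda>(a, b). (if a = b then 1 else 0) - v a * f b / s)"
  shows "E * F = 1\<^sub>m n"
proof (rule eq_matI)
  fix a b assume "a < dim_row (1\<^sub>m n :: complex mat)" "b < dim_col (1\<^sub>m n :: complex mat)"
  then have ab: "a < n" "b < n" by auto
  let ?d = "\<lambda>i j. if i = j then 1 else 0 :: complex"
  have E: "E \<in> carrier_mat n n" and F: "F \<in> carrier_mat n n" by (simp_all add: E_def F_def)
  have "(E * F) $$ (a, b) = (\<Sum>c<n. (?d a c + v a * f c) * (?d c b - v c * f b / s))"
    unfolding mult_mat_entry[OF E F ab] by (rule sum.cong) (use ab in \<open>auto simp: E_def F_def\<close>)
  also have "\<dots> = (\<Sum>c<n. ?d c a * (?d a b - v a * f b / s) + ?d c b * (v a * f b) - (v a * f b / s) * (f c * v c))"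
    by (rule sum.cong) (auto simp: algebra_simps)
  also have "\<dots> = (\<Sum>c<n. ?d c a * (?d a b - v a * f b / s)) + (\<Sum>c<n. ?d c b * (v a * f b))
      - (v a * f b / s) * (\<Sum>c<n. f c * v c)"
    by (simp only: sum.distrib sum_subtractf sum_distrib_left)
  also have "(\<Sum>c<n. f c * v c) = s - 1" using s(1) by (simp add: algebra_simps)
  also have "(\<Sum>c<n. ?d c a * (?d a b - v a * f b / s)) = ?d a b - v a * f b / s"
    using ab by (subst sum.remove[of _ a]) auto
  also have "(\<Sum>c<n. ?d c b * (v a * f b)) = v a * f b"
    using ab by (subst sum.remove[of _ b]) auto
  also have "?d a b - v a * f b / s + v a * f b - v a * f b / s * (s - 1) = ?d a b"
    using s(2) by (simp add: field_simps)
  finally show "(E * F) $$ (a, b) = 1\<^sub>m n $$ (a, b)" using ab by simp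
qed (simp_all add: E_def F_def)

lemma mult_mat_unit_vec:
  fixes A :: "'a::semiring_1 mat"
  assumes "A \<in> carrier_mat n m" "j < m"
  shows "A *\<^sub>v unit_vec m j = col A j"
  by (rule eq_vecI) (use assms in auto)

text \<open>The columns of \<open>S\<close> form a basis of the whole space of which as many as possible, namely the first
\<open>k\<close>, lie in \<open>W\<close>. By maximality \<open>W\<close> is contained in their span: if some \<open>w\<close> in \<open>W\<close> had a nonzero
coordinate beyond \<open>k\<close>, the exchange of one basis vector for \<open>w\<close> would give \<open>k + 1\<close> columns in \<open>W\<close>.\<close>

lemma adapted_basis:
  fixes W :: "complex vec set"
  assumes W: "W \<subseteq> carrier_vec n"
  obtains S S' k where "S \<in> carrier_mat n n" "S' \<in> carrier_mat n n" "S * S' = 1\<^sub>m n" "S' * S = 1\<^sub>m n"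
    "k \<le> n" "\<And>j. j < k \<Longrightarrow> col S j \<in> W"
    "\<And>w i. w \<in> W \<Longrightarrow> k \<le> i \<Longrightarrow> i < n \<Longrightarrow> (S' *\<^sub>v w) $ i = 0"
proof -
  define P where "P k S S' \<longleftrightarrow> k \<le> n \<and> S \<in> carrier_mat n n \<and> S' \<in> carrier_mat n n \<and>
    S * S' = 1\<^sub>m n \<and> S' * S = 1\<^sub>m n \<and> (\<forall>j<k. col S j \<in> W)" for k S S'
  define Q where "Q k \<longleftrightarrow> (\<exists>S S'. P k S S')" for k
  have "P 0 (1\<^sub>m n) (1\<^sub>m n)" by (simp add: P_def)
  then have "Q 0" by (auto simp: Q_def)
  moreover have bd: "\<forall>k. Q k \<longrightarrow> k \<le> n" by (auto simp: Q_def P_def)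
  ultimately have "Q (Greatest Q)" by (intro GreatestI_nat[of Q 0 n]) auto
  then obtain S S' where PS: "P (Greatest Q) S S'" by (auto simp: Q_def)
  define k where "k = Greatest Q"
  have S: "k \<le> n" "S \<in> carrier_mat n n" "S' \<in> carrier_mat n n" "S * S' = 1\<^sub>m n" "S' * S = 1\<^sub>m n"
    "\<And>j. j < k \<Longrightarrow> col S j \<in> W" using PS by (auto simp: P_def k_def)
  have "(S' *\<^sub>v w) $ i = 0" if w: "w \<in> W" and i: "k \<le> i" "i < n" for w i
  proof (rule ccontr)
    assume nz: "(S' *\<^sub>v w) $ i \<noteq> 0"
    have wc: "w \<in> carrier_vec n" using w W by auto
    have k: "k < n" using i by simp
    define u where "u = S' *\<^sub>v w"
    have uc: "u \<in> carrier_vec n" using S wc by (auto simp: u_def)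
    \<comment> \<open>The perturbation has to send the unit vector of \<open>k\<close> to \<open>u\<close> and fix those below \<open>k\<close>. The
      functional \<open>f\<close> therefore is \<open>1\<close> at \<open>k\<close> and \<open>0\<close> below; its value at \<open>i\<close> keeps \<open>s\<close>, the value of \<open>f\<close>
      at \<open>u\<close>, different from \<open>0\<close>.\<close>
    define f where "f b = (if b = k then 1 else if b = i \<and> u $ k = 0 then 1 else 0 :: complex)" for b
    define v where "v a = u $ a - (if a = k then 1 else 0)" for a
    define s where "s = 1 + (\<Sum>c<n. f c * v c)"
    have "s \<noteq> 0"
    proof (cases "u $ k = 0")
      case False
      have "(\<Sum>c<n. f c * v c) = (\<Sum>c<n. if c = k then v k else 0)"
        by (rule sum.cong) (use False in \<open>auto simp: f_def\<close>)
      then show ?thesis using k False by (simp add: s_def v_def)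
    next
      case True
      then have ik: "i \<noteq> k" using nz by (auto simp: u_def)
      have "(\<Sum>c<n. f c * v c) = (\<Sum>c<n. (if c = k then v k else 0) + (if c = i then v i else 0))"
        by (rule sum.cong) (use True ik in \<open>auto simp: f_def\<close>)
      also have "\<dots> = v k + v i" using k i by (simp add: sum.distrib)
      finally show ?thesis using nz ik True by (simp add: s_def v_def u_def)
    qed
    define E where "E = mat n n (\<lambda>(a, b). (if a = b then 1 else 0) + v a * f b)"
    define F where "F = mat n n (\<lambda>(a, b). (if a = b then 1 else 0) - v a * f b / s)"
    have Ec: "E \<in> carrier_mat n n" and Fc: "F \<in> carrier_mat n n" by (simp_all add: E_def F_def)
    have EF: "E * F = 1\<^sub>m n"
      unfolding E_def F_def by (rule rank_one_perturbation_inverse[OF s_def[symmetric] \<open>s \<noteq> 0\<close>])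
    have inv1: "S * E * (F * S') = 1\<^sub>m n"
    proof -
      have "S * E * (F * S') = S * ((E * F) * S')"
        using S Ec Fc by (simp add: assoc_mult_mat[of _ n n _ n _ n])
      then show ?thesis using S EF by simp
    qed
    then have inv2: "F * S' * (S * E) = 1\<^sub>m n"
      by (rule mat_mult_left_right_inverse[rotated 2]) (use S Ec Fc in auto)
    have "col (S * E) j \<in> W" if j: "j < Suc k" for j
    proof (cases "j = k")
      case True
      have "col E k = u"
        by (rule eq_vecI) (use k uc in \<open>auto simp: E_def v_def f_def\<close>)
      then have "col (S * E) j = S *\<^sub>v u" using True col_mult2[OF S(2) Ec k] by simp
      also have "\<dots> = (S * S') *\<^sub>v w"
        unfolding u_def by (rule assoc_mult_mat_vec[OF S(2,3) wc, symmetric])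
      also have "\<dots> = w" unfolding S(4) using wc by simp
      finally show ?thesis using w by simp
    next
      case False
      then have jk: "j < k" using j by simp
      have "col E j = unit_vec n j"
        by (rule eq_vecI) (use jk k i in \<open>auto simp: E_def f_def unit_vec_def\<close>)
      then have "col (S * E) j = S *\<^sub>v unit_vec n j"
        using col_mult2[OF S(2) Ec, of j] jk k by simp
      also have "\<dots> = col S j" using jk k by (intro mult_mat_unit_vec[OF S(2)]) simp
      finally show ?thesis using S(6)[OF jk] by simp
    qed
    then have "P (Suc k) (S * E) (F * S')"
      using S Ec Fc inv1 inv2 k by (auto simp: P_def)
    then have "Q (Suc k)" by (auto simp: Q_def)
    then have "Suc k \<le> k" unfolding k_def by (rule Greatest_le_nat[of Q _ n]) (use bd in auto)
    then show False by simp
  qed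
  then show ?thesis using that S by blast
qed

lemma adapted_basis_proper:
  fixes W :: "complex vec set"
  assumes sub: "VectorSpace.subspace class_ring W (module_vec TYPE(complex) n)"
    and W: "W \<noteq> {0\<^sub>v n}" "W \<noteq> carrier_vec n"
  obtains S S' k where "S \<in> carrier_mat n n" "S' \<in> carrier_mat n n" "S * S' = 1\<^sub>m n" "S' * S = 1\<^sub>m n"
    "0 < k" "k < n" "\<And>j. j < k \<Longrightarrow> col S j \<in> W"
    "\<And>w i. w \<in> W \<Longrightarrow> k \<le> i \<Longrightarrow> i < n \<Longrightarrow> (S' *\<^sub>v w) $ i = 0"
proof -
  note W' = subspace_vecD[OF sub]
  obtain S S' k where S: "S \<in> carrier_mat n n" "S' \<in> carrier_mat n n" "S * S' = 1\<^sub>m n" "S' * S = 1\<^sub>m n"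
    "k \<le> n" "\<And>j. j < k \<Longrightarrow> col S j \<in> W"
    "\<And>w i. w \<in> W \<Longrightarrow> k \<le> i \<Longrightarrow> i < n \<Longrightarrow> (S' *\<^sub>v w) $ i = 0"
    using adapted_basis[OF W'(1)] by metis
  have recon: "S *\<^sub>v (S' *\<^sub>v w) = w" if "w \<in> carrier_vec n" for w
    using assoc_mult_mat_vec[OF S(1,2) that] that by (simp add: S(3))
  have "k \<noteq> 0"
  proof
    assume "k = 0"
    have "w = 0\<^sub>v n" if w: "w \<in> W" for w
    proof -
      have "S' *\<^sub>v w = 0\<^sub>v n"
        by (rule eq_vecI) (use S(2) S(7)[OF w] \<open>k = 0\<close> in auto)
      then have "w = S *\<^sub>v 0\<^sub>v n" using recon[of w] w W'(1) by auto
      then show ?thesis using S(1) by auto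
    qed
    with W'(2) W(1) show False by blast
  qed
  moreover have "k \<noteq> n"
  proof
    assume kn: "k = n"
    have "x \<in> W" if x: "x \<in> carrier_vec n" for x
    proof -
      \<comment> \<open>Closure under sums and scalar multiples is used for one column of \<open>S\<close> at a time.\<close>
      define y where "y = S' *\<^sub>v x"
      have "S *\<^sub>v vec n (\<lambda>i. if i < m then y $ i else 0) \<in> W" if "m \<le> n" for m
        using that
      proof (induction m)
        case 0
        have "vec n (\<lambda>i. 0 :: complex) = 0\<^sub>v n" by auto
        then have "S *\<^sub>v vec n (\<lambda>i. if i < 0 then y $ i else 0) = 0\<^sub>v n" using S(1) by auto
        then show ?case using W'(2) by simp
      next
        case (Suc m)
        then have m: "m < n" by simp
        have "vec n (\<lambda>i. if i < Suc m then y $ i else 0)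
            = vec n (\<lambda>i. if i < m then y $ i else 0) + y $ m \<cdot>\<^sub>v unit_vec n m"
          by (rule eq_vecI) (auto simp: unit_vec_def less_Suc_eq)
        then have "S *\<^sub>v vec n (\<lambda>i. if i < Suc m then y $ i else 0)
            = S *\<^sub>v vec n (\<lambda>i. if i < m then y $ i else 0) + y $ m \<cdot>\<^sub>v col S m"
          using S(1) mult_mat_unit_vec[OF S(1) m]
          by (simp add: mult_add_distrib_mat_vec[of S n n] mult_mat_vec[of S n n])
        then show ?case using Suc m W'(3,4) S(6)[of m] kn by simp
      qed
      from this[of n] have "S *\<^sub>v vec n (\<lambda>i. if i < n then y $ i else 0) \<in> W" by simp
      also have "vec n (\<lambda>i. if i < n then y $ i else 0) = y"
        by (rule eq_vecI) (use S(2) in \<open>auto simp: y_def\<close>)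
      finally show ?thesis using recon[OF x] by (simp add: y_def)
    qed
    with W(2) W'(1) show False by blast
  qed
  ultimately have "0 < k" "k < n" using S(5) by auto
  then show ?thesis using that[OF S(1-4)] S(6,7) by blast
qed

section \<open>Representations of a finite group and their characters\<close>

definition character :: "'g rep \<Rightarrow> 'g \<Rightarrow> complex" where
  "character \<rho> g = mtrace (\<rho> g)"

locale finite_group = group G for G (structure) +
  assumes finite_carrier [simp]: "finite (carrier G)"
begin

lemma order_pos: "card (carrier G) > 0"
  by (simp add: card_gt_0_iff) (use one_closed in blast)

lemma sum_translate: "h \<in> carrier G \<Longrightarrow> (\<Sum>g\<in>carrier G. f (h \<otimes> g)) = (\<Sum>g\<in>carrier G. f g)"
  by (rule sum.reindex_bij_witness[of _ "\<lambda>g. inv h \<otimes> g" "\<lambda>g. h \<otimes> g"])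
    (auto simp: m_assoc[symmetric])

lemma rep_carrier:
  "representation G \<rho> \<Longrightarrow> g \<in> carrier G \<Longrightarrow> \<rho> g \<in> carrier_mat (rep_dim G \<rho>) (rep_dim G \<rho>)"
  by (simp add: representation_def)

lemma rep_mult:
  "representation G \<rho> \<Longrightarrow> g \<in> carrier G \<Longrightarrow> h \<in> carrier G \<Longrightarrow> \<rho> (g \<otimes> h) = \<rho> g * \<rho> h"
  by (simp add: representation_def)

lemma rep_one: "representation G \<rho> \<Longrightarrow> \<rho> \<one> = 1\<^sub>m (rep_dim G \<rho>)"
  by (simp add: representation_def)

lemma rep_inv:
  assumes "representation G \<rho>" "g \<in> carrier G"
  shows "\<rho> (inv g) * \<rho> g = 1\<^sub>m (rep_dim G \<rho>)" "\<rho> g * \<rho> (inv g) = 1\<^sub>m (rep_dim G \<rho>)"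
  using assms by (simp_all flip: rep_mult rep_one)

lemma representationI:
  assumes "\<And>g. g \<in> carrier G \<Longrightarrow> \<rho> g \<in> carrier_mat n n" "\<rho> \<one> = 1\<^sub>m n"
    and "\<And>g h. g \<in> carrier G \<Longrightarrow> h \<in> carrier G \<Longrightarrow> \<rho> (g \<otimes> h) = \<rho> g * \<rho> h"
  shows "representation G \<rho>" "rep_dim G \<rho> = n"
  using assms by (simp_all add: representation_def rep_dim_def)

lemma irr_rep: "irreducible_rep G \<rho> \<Longrightarrow> representation G \<rho>"
  and irr_dim_pos: "irreducible_rep G \<rho> \<Longrightarrow> rep_dim G \<rho> > 0"
  by (simp_all add: irreducible_rep_def)

definition intertwiner :: "'a rep \<Rightarrow> 'a rep \<Rightarrow> complex mat \<Rightarrow> bool" where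
  "intertwiner \<rho> \<sigma> T \<longleftrightarrow> T \<in> carrier_mat (rep_dim G \<sigma>) (rep_dim G \<rho>)
     \<and> (\<forall>g\<in>carrier G. T * \<rho> g = \<sigma> g * T)"

lemma rep_isoI:
  assumes "intertwiner \<rho> \<sigma> T" "T' \<in> carrier_mat (rep_dim G \<rho>) (rep_dim G \<sigma>)"
    and "T * T' = 1\<^sub>m (rep_dim G \<sigma>)" "T' * T = 1\<^sub>m (rep_dim G \<rho>)"
  shows "rep_iso G \<rho> \<sigma>"
proof -
  have T: "T \<in> carrier_mat (rep_dim G \<sigma>) (rep_dim G \<rho>)"
    using assms(1) by (simp add: intertwiner_def)
  have "mtrace (T * T') = mtrace (T' * T)" by (rule mtrace_mult_commute) (use T assms in auto)
  then have "of_nat (rep_dim G \<sigma>) = (of_nat (rep_dim G \<rho>) :: complex)" by (simp add: assms)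
  then have "rep_dim G \<sigma> = rep_dim G \<rho>" by (simp only: of_nat_eq_iff)
  then have "invertible_mat T"
    using T assms(2-) by (auto simp: invertible_mat_def inverts_mat_def intro!: exI[of _ T'])
  then show ?thesis using assms(1) T by (auto simp: rep_iso_def intertwiner_def)
qed

lemma rep_isoE:
  assumes "rep_iso G \<rho> \<sigma>"
  obtains T T' where "intertwiner \<rho> \<sigma> T" "rep_dim G \<sigma> = rep_dim G \<rho>"
    "T \<in> carrier_mat (rep_dim G \<rho>) (rep_dim G \<rho>)" "T' \<in> carrier_mat (rep_dim G \<rho>) (rep_dim G \<rho>)"
    "T * T' = 1\<^sub>m (rep_dim G \<rho>)" "T' * T = 1\<^sub>m (rep_dim G \<rho>)"
proof -
  from assms obtain T where T: "T \<in> carrier_mat (rep_dim G \<sigma>) (rep_dim G \<rho>)" "invertible_mat T"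
    "\<forall>g\<in>carrier G. T * \<rho> g = \<sigma> g * T" by (auto simp: rep_iso_def)
  from T(2) obtain T' where sq: "dim_row T = dim_col T" and T': "T * T' = 1\<^sub>m (dim_row T)" "T' * T = 1\<^sub>m (dim_row T')"
    by (auto simp: invertible_mat_def inverts_mat_def)
  have d: "rep_dim G \<sigma> = rep_dim G \<rho>" using T sq by auto
  have "dim_col T' = dim_row T" using T'(1) by (metis index_mult_mat(3) index_one_mat(3))
  moreover have "dim_row T' = dim_col T" using T'(2) by (metis index_mult_mat(3) index_one_mat(3))
  ultimately have "T' \<in> carrier_mat (rep_dim G \<rho>) (rep_dim G \<rho>)" using T sq by auto
  then show ?thesis using that[of T T'] T T' d by (auto simp: intertwiner_def)
qed

lemma rep_iso_refl: "representation G \<rho> \<Longrightarrow> rep_iso G \<rho> \<rho>"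
  by (rule rep_isoI[where T="1\<^sub>m (rep_dim G \<rho>)" and T'="1\<^sub>m (rep_dim G \<rho>)"])
    (auto simp: intertwiner_def left_mult_one_mat[OF rep_carrier] right_mult_one_mat[OF rep_carrier])

lemma rep_iso_trans:
  assumes "representation G \<rho>" "representation G \<sigma>" "representation G \<tau>"
    and "rep_iso G \<rho> \<sigma>" "rep_iso G \<sigma> \<tau>"
  shows "rep_iso G \<rho> \<tau>"
proof -
  let ?n = "rep_dim G \<rho>"
  obtain S S' where S: "intertwiner \<rho> \<sigma> S" "rep_dim G \<sigma> = ?n" "S \<in> carrier_mat ?n ?n"
    "S' \<in> carrier_mat ?n ?n" "S * S' = 1\<^sub>m ?n" "S' * S = 1\<^sub>m ?n"
    using assms(4) by (rule rep_isoE)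
  obtain T T' where T: "intertwiner \<sigma> \<tau> T" "rep_dim G \<tau> = ?n" "T \<in> carrier_mat ?n ?n"
    "T' \<in> carrier_mat ?n ?n" "T * T' = 1\<^sub>m ?n" "T' * T = 1\<^sub>m ?n"
    by (rule rep_isoE[OF assms(5), unfolded S(2)])
  have "intertwiner \<rho> \<tau> (T * S)"
    unfolding intertwiner_def
  proof (intro conjI ballI)
    fix g assume g: "g \<in> carrier G"
    have c: "\<rho> g \<in> carrier_mat ?n ?n" "\<sigma> g \<in> carrier_mat ?n ?n" "\<tau> g \<in> carrier_mat ?n ?n"
      using rep_carrier[OF assms(1) g] rep_carrier[OF assms(2) g] rep_carrier[OF assms(3) g]
      by (simp_all add: S(2) T(2))
    have i: "S * \<rho> g = \<sigma> g * S" "T * \<sigma> g = \<tau> g * T"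
      using S(1) T(1) g by (simp_all add: intertwiner_def)
    have "T * S * \<rho> g = T * (S * \<rho> g)" by (rule assoc_mult_mat[OF T(3) S(3) c(1)])
    also have "\<dots> = T * \<sigma> g * S" unfolding i(1) by (rule assoc_mult_mat[OF T(3) c(2) S(3), symmetric])
    also have "\<dots> = \<tau> g * (T * S)" unfolding i(2) by (rule assoc_mult_mat[OF c(3) T(3) S(3)])
    finally show "T * S * \<rho> g = \<tau> g * (T * S)" .
  qed (use S T in auto)
  moreover have "T * S * (S' * T') = 1\<^sub>m ?n"
  proof -
    have "T * S * (S' * T') = T * ((S * S') * T')"
      using S(3,4) T(3,4) by (simp add: assoc_mult_mat[of _ ?n ?n _ ?n _ ?n])
    then show ?thesis using S T by simp
  qed
  moreover have "S' * T' * (T * S) = 1\<^sub>m ?n"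
  proof -
    have "S' * T' * (T * S) = S' * ((T' * T) * S)"
      using S(3,4) T(3,4) by (simp add: assoc_mult_mat[of _ ?n ?n _ ?n _ ?n])
    then show ?thesis using S T by simp
  qed
  ultimately show ?thesis
    by (intro rep_isoI[where T="T * S" and T'="S' * T'"]) (use S T in auto)
qed

lemma character_iso:
  assumes "representation G \<rho>" "representation G \<sigma>" "rep_iso G \<rho> \<sigma>" "g \<in> carrier G"
  shows "character \<rho> g = character \<sigma> g"
proof -
  let ?n = "rep_dim G \<rho>"
  obtain T T' where T: "intertwiner \<rho> \<sigma> T" "rep_dim G \<sigma> = ?n"
    "T \<in> carrier_mat ?n ?n" "T' \<in> carrier_mat ?n ?n" "T * T' = 1\<^sub>m ?n" "T' * T = 1\<^sub>m ?n"
    using assms(3) by (rule rep_isoE)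
  have c: "\<rho> g \<in> carrier_mat ?n ?n" "\<sigma> g \<in> carrier_mat ?n ?n"
    using rep_carrier[OF assms(1,4)] rep_carrier[OF assms(2,4)] by (simp_all add: T(2))
  have "T * \<rho> g * T' = \<sigma> g * T * T'" using T(1) assms(4) by (simp add: intertwiner_def)
  also have "\<dots> = \<sigma> g" using T c by (simp add: assoc_mult_mat[of _ ?n ?n _ ?n _ ?n])
  finally have "T * \<rho> g * T' = \<sigma> g" .
  with mtrace_conjugate[OF c(1) T(3,4,6)] show ?thesis by (simp add: character_def)
qed

lemma character_one: "representation G \<rho> \<Longrightarrow> character \<rho> \<one> = of_nat (rep_dim G \<rho>)"
  by (simp add: character_def rep_one)

section \<open>Schur's lemma and the orthogonality of irreducible characters\<close>

text \<open>The kernel and the range of an intertwiner are invariant subspaces, so a nonzero one is injective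
and surjective. Preimages of the unit vectors are the columns of a right inverse, which injectivity
makes a left inverse as well.\<close>

lemma schur_zero_or_iso:
  assumes irr: "irreducible_rep G \<rho>" "irreducible_rep G \<sigma>" and T: "intertwiner \<rho> \<sigma> T"
  shows "T = 0\<^sub>m (rep_dim G \<sigma>) (rep_dim G \<rho>) \<or> rep_iso G \<rho> \<sigma>"
proof -
  define m where "m = rep_dim G \<rho>"
  define n where "n = rep_dim G \<sigma>"
  have Tc: "T \<in> carrier_mat n m" and Tg: "\<And>g. g \<in> carrier G \<Longrightarrow> T * \<rho> g = \<sigma> g * T"
    using T by (auto simp: intertwiner_def m_def n_def)
  have c: "\<rho> g \<in> carrier_mat m m" "\<sigma> g \<in> carrier_mat n n" if "g \<in> carrier G" for g
    using irr that rep_carrier irr_rep by (auto simp: m_def n_def)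
  define K where "K = {v \<in> carrier_vec m. T *\<^sub>v v = 0\<^sub>v n}"
  define R where "R = {T *\<^sub>v v |v. v \<in> carrier_vec m}"
  have "VectorSpace.subspace class_ring K (module_vec TYPE(complex) m)"
    by (rule subspace_vecI) (use Tc in \<open>auto simp: K_def mult_add_distrib_mat_vec mult_mat_vec\<close>)
  moreover have "\<rho> g *\<^sub>v w \<in> K" if "g \<in> carrier G" "w \<in> K" for g w
  proof -
    have "T *\<^sub>v (\<rho> g *\<^sub>v w) = \<sigma> g *\<^sub>v (T *\<^sub>v w)"
      using that Tc c[OF that(1)] Tg[OF that(1)] assoc_mult_mat_vec[of T n m "\<rho> g" m w]
        assoc_mult_mat_vec[of "\<sigma> g" n n T m w] by (auto simp: K_def)
    then show ?thesis using that c[OF that(1)] by (auto simp: K_def)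
  qed
  ultimately have K: "K = {0\<^sub>v m} \<or> K = carrier_vec m"
    using irr(1) by (auto simp: irreducible_rep_def m_def)
  have "VectorSpace.subspace class_ring R (module_vec TYPE(complex) n)"
  proof (rule subspace_vecI)
    show "0\<^sub>v n \<in> R" unfolding R_def using Tc by (auto intro!: exI[of _ "0\<^sub>v m"])
    show "v + w \<in> R" if vw: "v \<in> R" "w \<in> R" for v w
    proof -
      from vw obtain x y where "v = T *\<^sub>v x" "w = T *\<^sub>v y" "x \<in> carrier_vec m" "y \<in> carrier_vec m"
        by (auto simp: R_def)
      then show ?thesis using Tc
        by (auto simp: R_def mult_add_distrib_mat_vec[symmetric] intro!: exI[of _ "x + y"])
    qed
    show "a \<cdot>\<^sub>v v \<in> R" if v: "v \<in> R" for a v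
    proof -
      from v obtain x where "v = T *\<^sub>v x" "x \<in> carrier_vec m" by (auto simp: R_def)
      then show ?thesis using Tc by (auto simp: R_def mult_mat_vec[symmetric] intro!: exI[of _ "a \<cdot>\<^sub>v x"])
    qed
  qed (use Tc in \<open>auto simp: R_def\<close>)
  moreover have "\<sigma> g *\<^sub>v w \<in> R" if g: "g \<in> carrier G" "w \<in> R" for g w
  proof -
    from g obtain x where x: "w = T *\<^sub>v x" "x \<in> carrier_vec m" by (auto simp: R_def)
    have "\<sigma> g *\<^sub>v (T *\<^sub>v x) = T *\<^sub>v (\<rho> g *\<^sub>v x)"
      using x Tc c[OF g(1)] Tg[OF g(1)] assoc_mult_mat_vec[of T n m "\<rho> g" m x]
        assoc_mult_mat_vec[of "\<sigma> g" n n T m x] by auto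
    then show ?thesis using x c[OF g(1)] by (auto simp: R_def)
  qed
  ultimately have R: "R = {0\<^sub>v n} \<or> R = carrier_vec n"
    using irr(2) by (auto simp: irreducible_rep_def n_def)
  show ?thesis
  proof (cases "T = 0\<^sub>m n m")
    case False
    have "\<exists>v\<in>carrier_vec m. T *\<^sub>v v \<noteq> 0\<^sub>v n"
    proof (rule ccontr)
      assume "\<not> ?thesis"
      then have "T = 0\<^sub>m n m" by (intro mat_eq_on_vecs[of _ n m]) (use Tc in auto)
      with False show False by simp
    qed
    then have "K \<noteq> carrier_vec m" "R \<noteq> {0\<^sub>v n}" by (auto simp: K_def R_def)
    with K R have K0: "K = {0\<^sub>v m}" and R1: "R = carrier_vec n" by auto
    have "\<forall>j. \<exists>v. v \<in> carrier_vec m \<and> T *\<^sub>v v = unit_vec n j"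
    proof
      fix j have "unit_vec n j \<in> R" by (simp add: R1)
      then show "\<exists>v. v \<in> carrier_vec m \<and> T *\<^sub>v v = unit_vec n j" by (auto simp: R_def)
    qed
    then obtain s where s: "\<And>j. s j \<in> carrier_vec m" "\<And>j. T *\<^sub>v s j = unit_vec n j" by metis
    define S where "S = mat m n (\<lambda>(i, j). s j $ i)"
    have Sc: "S \<in> carrier_mat m n" by (simp add: S_def)
    have colS: "col S j = s j" if "j < n" for j
      using that s(1)[of j] by (intro eq_vecI) (auto simp: S_def)
    have TS: "T * S = 1\<^sub>m n"
    proof (rule eq_matI)
      fix i j assume "i < dim_row (1\<^sub>m n :: complex mat)" "j < dim_col (1\<^sub>m n :: complex mat)"
      then have ij: "i < n" "j < n" by auto
      have "(T * S) $$ (i, j) = (T *\<^sub>v s j) $ i" using ij Tc Sc colS by simp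
      then show "(T * S) $$ (i, j) = 1\<^sub>m n $$ (i, j)" using ij s(2)[of j] by (simp add: unit_vec_def)
    qed (use Tc Sc in auto)
    have ST: "S * T = 1\<^sub>m m"
    proof (rule mat_eq_on_vecs[of _ m m])
      fix v :: "complex vec" assume v: "v \<in> carrier_vec m"
      have "T *\<^sub>v (S * T *\<^sub>v v - v) = T *\<^sub>v (S * T *\<^sub>v v) - T *\<^sub>v v"
        using v Tc Sc by (intro mult_minus_distrib_mat_vec) auto
      also have "T *\<^sub>v (S * T *\<^sub>v v) = (T * S) *\<^sub>v (T *\<^sub>v v)"
        using v Tc Sc by (simp add: assoc_mult_mat_vec[of _ _ m] assoc_mult_mat_vec[of _ _ n])
      also have "\<dots> - T *\<^sub>v v = 0\<^sub>v n" using v Tc by (simp add: TS)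
      finally have "S * T *\<^sub>v v - v \<in> K" using v Tc Sc by (auto simp: K_def)
      then have z: "S * T *\<^sub>v v - v = 0\<^sub>v m" by (simp add: K0)
      show "S * T *\<^sub>v v = 1\<^sub>m m *\<^sub>v v"
      proof (rule eq_vecI)
        fix i assume "i < dim_vec (1\<^sub>m m *\<^sub>v v)"
        then have i: "i < m" by simp
        have "(S * T *\<^sub>v v - v) $ i = 0" using z i by simp
        then show "(S * T *\<^sub>v v) $ i = (1\<^sub>m m *\<^sub>v v) $ i" using v i Sc Tc by simp
      qed (use v Sc Tc in auto)
    qed (use Tc Sc in auto)
    show ?thesis using rep_isoI[OF T, of S] Sc TS ST by (simp add: m_def n_def)
  qed (simp add: m_def n_def)
qed

text \<open>An eigenspace of an intertwiner is invariant and nonzero, hence everything.\<close>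

lemma schur_scalar:
  assumes irr: "irreducible_rep G \<rho>" and T: "intertwiner \<rho> \<rho> T"
  shows "\<exists>c. T = c \<cdot>\<^sub>m 1\<^sub>m (rep_dim G \<rho>)"
proof -
  define n where "n = rep_dim G \<rho>"
  have Tc: "T \<in> carrier_mat n n" and Tg: "\<And>g. g \<in> carrier G \<Longrightarrow> T * \<rho> g = \<rho> g * T"
    using T by (auto simp: intertwiner_def n_def)
  have c: "\<rho> g \<in> carrier_mat n n" if "g \<in> carrier G" for g
    using irr that rep_carrier irr_rep by (auto simp: n_def)
  have "spectrum T \<noteq> {}" using spectrum_non_empty[OF Tc] irr_dim_pos[OF irr] by (simp add: n_def)
  then obtain k v where v: "v \<in> carrier_vec n" "v \<noteq> 0\<^sub>v n" "T *\<^sub>v v = k \<cdot>\<^sub>v v"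
    using Tc by (auto simp: spectrum_def eigenvalue_def eigenvector_def)
  define K where "K = {w \<in> carrier_vec n. T *\<^sub>v w = k \<cdot>\<^sub>v w}"
  have "VectorSpace.subspace class_ring K (module_vec TYPE(complex) n)"
  proof (rule subspace_vecI)
    show "u + w \<in> K" if "u \<in> K" "w \<in> K" for u w
      using that Tc by (auto simp: K_def mult_add_distrib_mat_vec smult_add_distrib_vec)
    show "a \<cdot>\<^sub>v w \<in> K" if "w \<in> K" for a w
      using that Tc by (auto simp: K_def mult_mat_vec smult_smult_assoc mult.commute)
  qed (use Tc in \<open>auto simp: K_def\<close>)
  moreover have "\<rho> g *\<^sub>v w \<in> K" if g: "g \<in> carrier G" "w \<in> K" for g w
  proof -
    have "T *\<^sub>v (\<rho> g *\<^sub>v w) = \<rho> g *\<^sub>v (T *\<^sub>v w)"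
      using g Tc c[OF g(1)] Tg[OF g(1)] assoc_mult_mat_vec[of T n n "\<rho> g" n w]
        assoc_mult_mat_vec[of "\<rho> g" n n T n w] by (auto simp: K_def)
    then show ?thesis using g c[OF g(1)] by (auto simp: K_def mult_mat_vec)
  qed
  ultimately have "K = {0\<^sub>v n} \<or> K = carrier_vec n"
    using irr by (auto simp: irreducible_rep_def n_def)
  moreover have "v \<in> K" using v by (simp add: K_def)
  ultimately have "K = carrier_vec n" using v(2) by auto
  moreover have "(k \<cdot>\<^sub>m 1\<^sub>m n) *\<^sub>v w = k \<cdot>\<^sub>v w" if "w \<in> carrier_vec n" for w
    by (rule eq_vecI) (use that in \<open>auto simp: row_smult smult_scalar_prod_distrib[of _ n]\<close>)
  ultimately have "T = k \<cdot>\<^sub>m 1\<^sub>m n"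
    by (intro mat_eq_on_vecs[of _ n n]) (use Tc in \<open>auto simp: K_def\<close>)
  then show ?thesis by (auto simp: n_def)
qed

text \<open>Up to the factor \<open>card (carrier G)\<close>, the projection of a linear map onto the intertwiners.\<close>

definition average :: "'a rep \<Rightarrow> 'a rep \<Rightarrow> complex mat \<Rightarrow> complex mat" where
  "average \<rho> \<sigma> X = mat_sum (rep_dim G \<sigma>) (rep_dim G \<rho>) (\<lambda>g. \<sigma> g * X * \<rho> (inv g)) (carrier G)"

lemma intertwiner_average:
  assumes "representation G \<rho>" "representation G \<sigma>" "X \<in> carrier_mat (rep_dim G \<sigma>) (rep_dim G \<rho>)"
  shows "intertwiner \<rho> \<sigma> (average \<rho> \<sigma> X)"
  unfolding intertwiner_def
proof (intro conjI ballI)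
  let ?m = "rep_dim G \<rho>" and ?n = "rep_dim G \<sigma>"
  fix h assume h: "h \<in> carrier G"
  have c: "\<rho> g \<in> carrier_mat ?m ?m" "\<sigma> g \<in> carrier_mat ?n ?n" if "g \<in> carrier G" for g
    using that assms by (auto intro: rep_carrier)
  have F: "\<sigma> g * X * \<rho> (inv g) \<in> carrier_mat ?n ?m" if "g \<in> carrier G" for g
    using that c[OF that] c(1)[OF inv_closed[OF that]] assms(3) by auto
  have "\<sigma> h * average \<rho> \<sigma> X = mat_sum ?n ?m (\<lambda>g. \<sigma> h * (\<sigma> g * X * \<rho> (inv g))) (carrier G)"
    unfolding average_def by (rule mult_mat_sum) (use h c F in auto)
  also have "\<dots> = mat_sum ?n ?m (\<lambda>g. \<sigma> (h \<otimes> g) * X * \<rho> (inv (h \<otimes> g)) * \<rho> h) (carrier G)"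
  proof (rule mat_sum_cong)
    fix g assume g: "g \<in> carrier G"
    have "\<rho> (inv g) = \<rho> (inv (h \<otimes> g)) * \<rho> h"
      using g h by (simp add: rep_mult[OF assms(1), symmetric] inv_mult_group m_assoc)
    moreover have "\<sigma> (h \<otimes> g) = \<sigma> h * \<sigma> g" using rep_mult[OF assms(2)] g h by simp
    moreover note cc = c[OF g] c[OF h] c(1)[of "inv (h \<otimes> g)"] c(2)[of "h \<otimes> g"] assms(3) g h
    ultimately show "\<sigma> h * (\<sigma> g * X * \<rho> (inv g)) = \<sigma> (h \<otimes> g) * X * \<rho> (inv (h \<otimes> g)) * \<rho> h"
      by (simp add: assoc_mult_mat[of _ ?n ?n _ ?n _ ?m] assoc_mult_mat[of _ ?n ?n _ ?m _ ?m]
          assoc_mult_mat[of _ ?n ?m _ ?m _ ?m])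
  qed
  also have "\<dots> = mat_sum ?n ?m (\<lambda>g. \<sigma> g * X * \<rho> (inv g) * \<rho> h) (carrier G)"
    by (simp add: mat_sum_def sum_translate[OF h, of "\<lambda>g. (\<sigma> g * X * \<rho> (inv g) * \<rho> h) $$ _"])
  also have "\<dots> = average \<rho> \<sigma> X * \<rho> h"
    unfolding average_def by (rule mat_sum_mult[symmetric]) (use h c F in auto)
  finally show "average \<rho> \<sigma> X * \<rho> h = \<sigma> h * average \<rho> \<sigma> X" by simp
qed (simp add: average_def)

definition unit_mat :: "nat \<Rightarrow> nat \<Rightarrow> nat \<Rightarrow> nat \<Rightarrow> complex mat" where
  "unit_mat n m i j = mat n m (\<lambda>(a, b). if a = i \<and> b = j then 1 else 0)"

lemma unit_mat_sandwich:
  assumes "A \<in> carrier_mat n n" "B \<in> carrier_mat m m" "i < n" "j < m" "a < n" "b < m"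
  shows "(A * unit_mat n m i j * B) $$ (a, b) = A $$ (a, i) * B $$ (j, b)"
proof -
  have U: "unit_mat n m i j \<in> carrier_mat n m" by (simp add: unit_mat_def)
  have AU: "A * unit_mat n m i j \<in> carrier_mat n m" using assms U by auto
  have "(A * unit_mat n m i j * B) $$ (a, b) = (\<Sum>k<m. (A * unit_mat n m i j) $$ (a, k) * B $$ (k, b))"
    by (rule mult_mat_entry[OF AU assms(2,5,6)])
  also have "\<dots> = (\<Sum>k<m. (if k = j then A $$ (a, i) * B $$ (k, b) else 0))"
  proof (rule sum.cong[OF refl])
    fix k assume "k \<in> {..<m}"
    then have k: "k < m" by simp
    have "(A * unit_mat n m i j) $$ (a, k) = (\<Sum>l<n. if l = i then (if k = j then A $$ (a, i) else 0) else 0)"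
      unfolding mult_mat_entry[OF assms(1) U assms(5) k]
      by (rule sum.cong) (use k in \<open>auto simp: unit_mat_def\<close>)
    then show "(A * unit_mat n m i j) $$ (a, k) * B $$ (k, b) = (if k = j then A $$ (a, i) * B $$ (k, b) else 0)"
      using assms(3) by simp
  qed
  also have "\<dots> = A $$ (a, i) * B $$ (j, b)" using assms(4) by simp
  finally show ?thesis .
qed

text \<open>The conjugation of the Hermitian inner product is replaced by inversion in the group. For characters
the two agree, and orthogonality then needs no unitary structure.\<close>

definition char_inner :: "('a \<Rightarrow> complex) \<Rightarrow> ('a \<Rightarrow> complex) \<Rightarrow> complex" where
  "char_inner \<phi> \<psi> = (\<Sum>g\<in>carrier G. \<phi> (inv g) * \<psi> g) / of_nat (card (carrier G))"

text \<open>The sandwiched unit matrix \<open>\<sigma> g * E\<^sub>i\<^sub>j * \<rho> (inv g)\<close> has \<open>\<sigma> g $$ (i, i) * \<rho> (inv g) $$ (j, j)\<close> at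
position \<open>(i, j)\<close>. So averages of unit matrices, to which Schur's lemma applies, determine the inner
product.\<close>

lemma sum_characters:
  assumes "representation G \<rho>" "representation G \<sigma>"
  shows "(\<Sum>g\<in>carrier G. character \<rho> (inv g) * character \<sigma> g) =
    (\<Sum>i<rep_dim G \<sigma>. \<Sum>j<rep_dim G \<rho>.
       average \<rho> \<sigma> (unit_mat (rep_dim G \<sigma>) (rep_dim G \<rho>) i j) $$ (i, j))"
proof -
  let ?m = "rep_dim G \<rho>" and ?n = "rep_dim G \<sigma>"
  have c: "\<rho> g \<in> carrier_mat ?m ?m" "\<sigma> g \<in> carrier_mat ?n ?n" if "g \<in> carrier G" for g
    using that assms by (auto intro: rep_carrier)
  have "(\<Sum>i<?n. \<Sum>j<?m. average \<rho> \<sigma> (unit_mat ?n ?m i j) $$ (i, j))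
     = (\<Sum>i<?n. \<Sum>j<?m. \<Sum>g\<in>carrier G. \<sigma> g $$ (i, i) * \<rho> (inv g) $$ (j, j))"
    by (intro sum.cong refl) (auto simp: average_def unit_mat_sandwich[OF c(2) c(1)] intro!: sum.cong)
  also have "\<dots> = (\<Sum>i<?n. \<Sum>g\<in>carrier G. \<Sum>j<?m. \<sigma> g $$ (i, i) * \<rho> (inv g) $$ (j, j))"
    by (intro sum.cong refl sum.swap)
  also have "\<dots> = (\<Sum>g\<in>carrier G. \<Sum>i<?n. \<Sum>j<?m. \<sigma> g $$ (i, i) * \<rho> (inv g) $$ (j, j))"
    by (rule sum.swap)
  also have "\<dots> = (\<Sum>g\<in>carrier G. character \<rho> (inv g) * character \<sigma> g)"
  proof (rule sum.cong[OF refl])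
    fix g assume g: "g \<in> carrier G"
    have "dim_row (\<rho> (inv g)) = ?m" "dim_row (\<sigma> g) = ?n" using c(1)[OF inv_closed[OF g]] c(2)[OF g] by auto
    then have "character \<rho> (inv g) * character \<sigma> g = (\<Sum>i<?n. \<sigma> g $$ (i, i)) * (\<Sum>j<?m. \<rho> (inv g) $$ (j, j))"
      by (simp add: character_def mtrace_def)
    then show "(\<Sum>i<?n. \<Sum>j<?m. \<sigma> g $$ (i, i) * \<rho> (inv g) $$ (j, j)) = character \<rho> (inv g) * character \<sigma> g"
      by (simp only: sum_product)
  qed
  finally show ?thesis by simp
qed

text \<open>Averages of unit matrices vanish if \<open>\<rho>\<close> and \<open>\<sigma>\<close> are not isomorphic. For \<open>\<sigma> = \<rho>\<close> they are scalar
matrices, and averaging multiplies the trace by the order of the group, which determines the scalar.\<close>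

lemma char_orthogonal:
  assumes irr: "irreducible_rep G \<rho>" "irreducible_rep G \<sigma>"
  shows "char_inner (character \<rho>) (character \<sigma>) = (if rep_iso G \<rho> \<sigma> then 1 else 0)"
proof (cases "rep_iso G \<rho> \<sigma>")
  case False
  note r = irr[THEN irr_rep]
  have "average \<rho> \<sigma> (unit_mat (rep_dim G \<sigma>) (rep_dim G \<rho>) i j) = 0\<^sub>m (rep_dim G \<sigma>) (rep_dim G \<rho>)" for i j
    using schur_zero_or_iso[OF irr intertwiner_average[OF r]] False by (simp add: unit_mat_def)
  then show ?thesis using False by (simp add: char_inner_def sum_characters[OF r])
next
  case True
  note r = irr[THEN irr_rep]
  let ?n = "rep_dim G \<rho>" and ?N = "of_nat (card (carrier G)) :: complex"
  have c: "\<rho> g \<in> carrier_mat ?n ?n" if "g \<in> carrier G" for g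
    using that r(1) by (auto intro: rep_carrier)
  have npos: "?n > 0" using irr_dim_pos[OF irr(1)] .
  have *: "average \<rho> \<rho> (unit_mat ?n ?n i j) $$ (i, j) = (if i = j then ?N / of_nat ?n else 0)"
    if ij: "i < ?n" "j < ?n" for i j
  proof -
    let ?X = "unit_mat ?n ?n i j"
    have X: "?X \<in> carrier_mat ?n ?n" by (simp add: unit_mat_def)
    obtain k where k: "average \<rho> \<rho> ?X = k \<cdot>\<^sub>m 1\<^sub>m ?n"
      using schur_scalar[OF irr(1) intertwiner_average[OF r(1) r(1) X]] by blast
    have "mtrace (average \<rho> \<rho> ?X) = (\<Sum>g\<in>carrier G. mtrace (\<rho> g * ?X * \<rho> (inv g)))"
    proof -
      have "mtrace (average \<rho> \<rho> ?X) = (\<Sum>a<?n. \<Sum>g\<in>carrier G. (\<rho> g * ?X * \<rho> (inv g)) $$ (a, a))"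
        by (simp add: mtrace_def average_def)
      also have "\<dots> = (\<Sum>g\<in>carrier G. \<Sum>a<?n. (\<rho> g * ?X * \<rho> (inv g)) $$ (a, a))" by (rule sum.swap)
      also have "\<dots> = (\<Sum>g\<in>carrier G. mtrace (\<rho> g * ?X * \<rho> (inv g)))"
        by (intro sum.cong refl) (simp add: mtrace_def carrier_matD(1)[OF c])
      finally show ?thesis .
    qed
    also have "\<dots> = (\<Sum>g\<in>carrier G. mtrace ?X)"
      by (intro sum.cong refl mtrace_conjugate[OF X, where m="?n"]) (use c rep_inv[OF r(1)] in auto)
    also have "mtrace ?X = (if i = j then 1 else 0)"
    proof -
      have "mtrace ?X = (\<Sum>a<?n. if a = i then (if i = j then 1 else 0) else 0)"
        unfolding mtrace_def by (rule sum.cong) (auto simp: unit_mat_def)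
      then show ?thesis using ij by simp
    qed
    finally have "k * of_nat ?n = ?N * (if i = j then 1 else 0)"
      unfolding k by (simp add: mtrace_smult[OF one_carrier_mat])
    then have "k = (if i = j then ?N / of_nat ?n else 0)"
      using npos by (auto simp: field_simps split: if_splits)
    then show ?thesis unfolding k using ij by simp
  qed
  have "char_inner (character \<rho>) (character \<sigma>) = char_inner (character \<rho>) (character \<rho>)"
    unfolding char_inner_def using character_iso[OF r True] by (simp cong: sum.cong)
  also have "\<dots> = (\<Sum>i<?n. \<Sum>j<?n. average \<rho> \<rho> (unit_mat ?n ?n i j) $$ (i, j)) / ?N"
    unfolding char_inner_def sum_characters[OF r(1) r(1)] ..
  also have "(\<Sum>i<?n. \<Sum>j<?n. average \<rho> \<rho> (unit_mat ?n ?n i j) $$ (i, j))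
      = (\<Sum>i<?n. \<Sum>j<?n. if i = j then ?N / of_nat ?n else 0)"
    by (intro sum.cong refl *) auto
  also have "\<dots> = (\<Sum>i<?n. ?N / of_nat ?n)"
    by (intro sum.cong refl) simp
  also have "\<dots> / ?N = 1" using npos order_pos by auto
  finally show ?thesis using True by simp
qed

end

section \<open>Complete reducibility\<close>

lemma four_block_mat_inject:
  assumes eq: "four_block_mat A B C D = four_block_mat A' B' C' D'"
    and "A \<in> carrier_mat k k" "B \<in> carrier_mat k l" "C \<in> carrier_mat l k" "D \<in> carrier_mat l l"
    and "A' \<in> carrier_mat k k" "B' \<in> carrier_mat k l" "C' \<in> carrier_mat l k" "D' \<in> carrier_mat l l"
  shows "A = A'" "B = B'" "D = D'"
proof -
  have e: "four_block_mat A B C D $$ (i, j) = four_block_mat A' B' C' D' $$ (i, j)" for i j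
    by (simp only: eq)
  show "A = A'"
  proof (rule eq_matI)
    fix i j assume "i < dim_row A'" "j < dim_col A'"
    then show "A $$ (i, j) = A' $$ (i, j)" using e[of i j] assms(2-) by auto
  qed (use assms in auto)
  show "B = B'"
  proof (rule eq_matI)
    fix i j assume "i < dim_row B'" "j < dim_col B'"
    then show "B $$ (i, j) = B' $$ (i, j)" using e[of i "j + k"] assms(2-) by auto
  qed (use assms in auto)
  show "D = D'"
  proof (rule eq_matI)
    fix i j assume "i < dim_row D'" "j < dim_col D'"
    then show "D $$ (i, j) = D' $$ (i, j)" using e[of "i + k" "j + k"] assms(2-) by auto
  qed (use assms in auto)
qed

text \<open>The off-diagonal zero blocks have the form they have in \<open>diag_block_mat\<close>, so that \<open>direct_sum_rep\<close> is
an iteration of this sum of two.\<close>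

definition block_rep :: "'g rep \<Rightarrow> 'g rep \<Rightarrow> 'g rep" where
  "block_rep A D = (\<lambda>g. four_block_mat (A g) (0\<^sub>m (dim_row (A g)) (dim_col (D g)))
     (0\<^sub>m (dim_row (D g)) (dim_col (A g))) (D g))"

lemma direct_sum_rep_Nil: "direct_sum_rep [] = (\<lambda>g. 0\<^sub>m 0 0)"
  by (simp add: direct_sum_rep_def)

lemma direct_sum_rep_Cons: "direct_sum_rep (\<sigma> # \<sigma>s) = block_rep \<sigma> (direct_sum_rep \<sigma>s)"
  by (simp add: direct_sum_rep_def block_rep_def Let_def)

lemma direct_sum_rep_append:
  "direct_sum_rep (\<sigma>s @ \<tau>s) = block_rep (direct_sum_rep \<sigma>s) (direct_sum_rep \<tau>s)"
  by (simp add: direct_sum_rep_def block_rep_def Let_def diag_block_mat_append)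

lemma direct_sum_rep_single: "direct_sum_rep [\<sigma>] = \<sigma>"
  unfolding direct_sum_rep_def list.map diag_block_mat_singleton ..

lemma sum_lessThan_add:
  fixes f :: "nat \<Rightarrow> 'a::comm_monoid_add"
  shows "sum f {..<k + l} = sum f {..<k} + (\<Sum>i<l. f (k + i))"
  by (induction l) (simp_all add: add.assoc)

lemma mtrace_four_block:
  assumes "A \<in> carrier_mat k k" "D \<in> carrier_mat l l"
  shows "mtrace (four_block_mat A B C D) = mtrace A + mtrace D"
  using assms by (simp add: mtrace_def sum_lessThan_add)

context finite_group
begin

lemma block_rep_eq:
  assumes "representation G A" "representation G D" "g \<in> carrier G"
  shows "block_rep A D g = four_block_mat (A g) (0\<^sub>m (rep_dim G A) (rep_dim G D))
     (0\<^sub>m (rep_dim G D) (rep_dim G A)) (D g)"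
  using rep_carrier[OF assms(1,3)] rep_carrier[OF assms(2,3)] by (simp add: block_rep_def)

lemma representation_block:
  assumes A: "representation G A" and D: "representation G D"
  shows "representation G (block_rep A D)" "rep_dim G (block_rep A D) = rep_dim G A + rep_dim G D"
proof -
  let ?k = "rep_dim G A" and ?l = "rep_dim G D"
  note c = rep_carrier[OF A] rep_carrier[OF D]
  have 1: "block_rep A D g \<in> carrier_mat (?k + ?l) (?k + ?l)" if "g \<in> carrier G" for g
    using c[OF that] by (simp add: block_rep_eq[OF A D that])
  have 2: "block_rep A D \<one> = 1\<^sub>m (?k + ?l)"
    by (simp add: block_rep_eq[OF A D] rep_one[OF A] rep_one[OF D])
  have 3: "block_rep A D (g \<otimes> h) = block_rep A D g * block_rep A D h"
    if g: "g \<in> carrier G" and h: "h \<in> carrier G" for g h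
    unfolding block_rep_eq[OF A D g] block_rep_eq[OF A D h] block_rep_eq[OF A D m_closed[OF g h]]
    by (subst mult_four_block_mat[OF c(1)[OF g] zero_carrier_mat zero_carrier_mat c(2)[OF g]
          c(1)[OF h] zero_carrier_mat zero_carrier_mat c(2)[OF h]])
      (use c(1)[OF g] c(2)[OF g] c(1)[OF h] c(2)[OF h] in \<open>simp add: rep_mult[OF A g h] rep_mult[OF D g h]\<close>)
  show "representation G (block_rep A D)" "rep_dim G (block_rep A D) = ?k + ?l"
    using representationI[OF 1 2 3] by auto
qed

lemma character_block:
  assumes "representation G A" "representation G D" "g \<in> carrier G"
  shows "character (block_rep A D) g = character A g + character D g"
  unfolding character_def block_rep_eq[OF assms]
  by (rule mtrace_four_block[OF rep_carrier[OF assms(1,3)] rep_carrier[OF assms(2,3)]])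

lemma rep_iso_block:
  assumes r: "representation G A" "representation G D" "representation G A'" "representation G D'"
    and iso: "rep_iso G A A'" "rep_iso G D D'"
  shows "rep_iso G (block_rep A D) (block_rep A' D')"
proof -
  let ?k = "rep_dim G A" and ?l = "rep_dim G D"
  obtain S S' where S: "intertwiner A A' S" "rep_dim G A' = ?k" "S \<in> carrier_mat ?k ?k"
    "S' \<in> carrier_mat ?k ?k" "S * S' = 1\<^sub>m ?k" "S' * S = 1\<^sub>m ?k"
    by (rule rep_isoE[OF iso(1)])
  obtain T T' where T: "intertwiner D D' T" "rep_dim G D' = ?l" "T \<in> carrier_mat ?l ?l"
    "T' \<in> carrier_mat ?l ?l" "T * T' = 1\<^sub>m ?l" "T' * T = 1\<^sub>m ?l"
    by (rule rep_isoE[OF iso(2)])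
  let ?Z = "0\<^sub>m ?k ?l :: complex mat" and ?Z' = "0\<^sub>m ?l ?k :: complex mat"
  let ?U = "four_block_mat S ?Z ?Z' T" and ?U' = "four_block_mat S' ?Z ?Z' T'"
  have mul: "four_block_mat P ?Z ?Z' Q * four_block_mat P' ?Z ?Z' Q' = four_block_mat (P * P') ?Z ?Z' (Q * Q')"
    if "P \<in> carrier_mat ?k ?k" "P' \<in> carrier_mat ?k ?k" "Q \<in> carrier_mat ?l ?l" "Q' \<in> carrier_mat ?l ?l"
    for P P' Q Q'
    by (subst mult_four_block_mat[OF that(1) zero_carrier_mat zero_carrier_mat that(3)
          that(2) zero_carrier_mat zero_carrier_mat that(4)]) (use that in simp)
  have dims: "rep_dim G (block_rep A D) = ?k + ?l" "rep_dim G (block_rep A' D') = ?k + ?l"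
    using r S(2) T(2) by (simp_all add: representation_block)
  have U: "intertwiner (block_rep A D) (block_rep A' D') ?U"
    unfolding intertwiner_def dims
  proof (intro conjI ballI)
    fix g assume g: "g \<in> carrier G"
    have c: "A g \<in> carrier_mat ?k ?k" "D g \<in> carrier_mat ?l ?l" "A' g \<in> carrier_mat ?k ?k" "D' g \<in> carrier_mat ?l ?l"
      using rep_carrier[OF r(1) g] rep_carrier[OF r(2) g] rep_carrier[OF r(3) g] rep_carrier[OF r(4) g]
      by (simp_all add: S(2) T(2))
    show "?U * block_rep A D g = block_rep A' D' g * ?U"
      unfolding block_rep_eq[OF r(1,2) g] block_rep_eq[OF r(3,4) g] S(2) T(2)
      using S(1) T(1) g by (simp add: mul c S(3) T(3) intertwiner_def)
  qed (use S T in auto)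
  show ?thesis
    by (rule rep_isoI[OF U, of ?U']) (use S T in \<open>simp_all add: dims mul\<close>)
qed

lemma representation_direct_sum:
  "(\<And>\<sigma>. \<sigma> \<in> set \<sigma>s \<Longrightarrow> representation G \<sigma>) \<Longrightarrow> representation G (direct_sum_rep \<sigma>s)"
proof (induction \<sigma>s)
  case Nil
  show ?case unfolding direct_sum_rep_Nil by (rule representationI[where n=0]) (auto intro!: eq_matI)
next
  case (Cons \<sigma> \<sigma>s)
  then show ?case unfolding direct_sum_rep_Cons by (intro representation_block(1)) auto
qed

lemma character_direct_sum:
  "(\<And>\<sigma>. \<sigma> \<in> set \<sigma>s \<Longrightarrow> representation G \<sigma>) \<Longrightarrow> g \<in> carrier G \<Longrightarrow>
    character (direct_sum_rep \<sigma>s) g = (\<Sum>\<sigma>\<leftarrow>\<sigma>s. character \<sigma> g)"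
proof (induction \<sigma>s)
  case Nil
  then show ?case by (simp add: direct_sum_rep_Nil character_def mtrace_def)
next
  case (Cons \<sigma> \<sigma>s)
  then show ?case
    by (simp add: direct_sum_rep_Cons character_block representation_direct_sum)
qed

text \<open>In the block form the multiplication law reads \<open>B (g h) = A g * B h + B g * D h\<close>, so \<open>B\<close> is a cocycle.
Averaging makes it a coboundary: \<open>Y\<close>, the mean of \<open>A g * B (inv g)\<close>, satisfies \<open>A h * Y = B h + Y * D h\<close>,
and conjugation with the unipotent matrix of \<open>Y\<close> removes the block \<open>B\<close>.\<close>

lemma block_triangular_splits:
  assumes rep: "representation G \<rho>" and dim: "rep_dim G \<rho> = k + l"
    and fb: "\<And>g. g \<in> carrier G \<Longrightarrow> \<rho> g = four_block_mat (A g) (B g) (0\<^sub>m l k) (D g)"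
    and c: "\<And>g. A g \<in> carrier_mat k k" "\<And>g. B g \<in> carrier_mat k l" "\<And>g. D g \<in> carrier_mat l l"
  shows "representation G A" "rep_dim G A = k" "representation G D" "rep_dim G D = l"
    "rep_iso G \<rho> (block_rep A D)"
proof -
  have mul: "A (g \<otimes> h) = A g * A h" "B (g \<otimes> h) = A g * B h + B g * D h" "D (g \<otimes> h) = D g * D h"
    if g: "g \<in> carrier G" and h: "h \<in> carrier G" for g h
  proof -
    have "four_block_mat (A (g \<otimes> h)) (B (g \<otimes> h)) (0\<^sub>m l k) (D (g \<otimes> h)) = \<rho> g * \<rho> h"
      using fb[of "g \<otimes> h"] rep_mult[OF rep g h] g h by simp
    also have "\<dots> = four_block_mat (A g * A h + B g * 0\<^sub>m l k) (A g * B h + B g * D h)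
        (0\<^sub>m l k * A h + D g * 0\<^sub>m l k) (0\<^sub>m l k * B h + D g * D h)"
      unfolding fb[OF g] fb[OF h]
      by (rule mult_four_block_mat[OF c(1) c(2) zero_carrier_mat c(3) c(1) c(2) zero_carrier_mat c(3)])
    also have "\<dots> = four_block_mat (A g * A h) (A g * B h + B g * D h) (0\<^sub>m l k) (D g * D h)"
      using c(1)[of g] c(2)[of g] c(3)[of g] c(1)[of h] c(2)[of h] c(3)[of h] by simp
    finally have e: "four_block_mat (A (g \<otimes> h)) (B (g \<otimes> h)) (0\<^sub>m l k) (D (g \<otimes> h)) = \<dots>" .
    have cc: "A g * A h \<in> carrier_mat k k" "A g * B h + B g * D h \<in> carrier_mat k l" "D g * D h \<in> carrier_mat l l"
      using c(1)[of g] c(2)[of g] c(3)[of g] c(1)[of h] c(2)[of h] c(3)[of h] by auto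
    show "A (g \<otimes> h) = A g * A h" "B (g \<otimes> h) = A g * B h + B g * D h" "D (g \<otimes> h) = D g * D h"
      by (fact four_block_mat_inject[OF e c(1) c(2) zero_carrier_mat c(3) cc(1) cc(2) zero_carrier_mat cc(3)])+
  qed
  have "four_block_mat (A \<one>) (B \<one>) (0\<^sub>m l k) (D \<one>) = four_block_mat (1\<^sub>m k) (0\<^sub>m k l) (0\<^sub>m l k) (1\<^sub>m l)"
    using fb[of \<one>] rep_one[OF rep] dim by simp
  from four_block_mat_inject[OF this, of k l]
  have one: "A \<one> = 1\<^sub>m k" "D \<one> = 1\<^sub>m l" using c by auto
  show rA: "representation G A" "rep_dim G A = k"
    using representationI[of A k] c one mul by auto
  show rD: "representation G D" "rep_dim G D = l"
    using representationI[of D l] c one mul by auto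
  let ?N = "of_nat (card (carrier G)) :: complex"
  define Z where "Z = mat_sum k l (\<lambda>g. A g * B (inv g)) (carrier G)"
  have Zc: "Z \<in> carrier_mat k l" by (simp add: Z_def)
  have Z: "A h * Z = ?N \<cdot>\<^sub>m B h + Z * D h" if h: "h \<in> carrier G" for h
  proof -
    have ABc: "A g * B g' \<in> carrier_mat k l" for g g' using c(1)[of g] c(2)[of g'] by simp
    have "A h * Z = mat_sum k l (\<lambda>g. A h * (A g * B (inv g))) (carrier G)"
      unfolding Z_def by (rule mult_mat_sum[OF c(1) ABc])
    also have "\<dots> = mat_sum k l (\<lambda>g. B h + A (h \<otimes> g) * B (inv (h \<otimes> g)) * D h) (carrier G)"
    proof (rule mat_sum_cong)
      fix g assume g: "g \<in> carrier G"
      let ?g = "h \<otimes> g"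
      have gc: "?g \<in> carrier G" "inv ?g \<in> carrier G" using g h by auto
      have "inv g = inv ?g \<otimes> h" using g h by (simp add: inv_mult_group m_assoc)
      then have "B (inv g) = A (inv ?g) * B h + B (inv ?g) * D h" using mul(2)[OF gc(2) h] by simp
      moreover have "A h * (A g * B (inv g)) = A ?g * B (inv g)"
        using mul(1)[OF h g] by (simp add: assoc_mult_mat[OF c(1) c(1) c(2)])
      ultimately have "A h * (A g * B (inv g)) = A ?g * (A (inv ?g) * B h + B (inv ?g) * D h)" by simp
      also have "\<dots> = A ?g * (A (inv ?g) * B h) + A ?g * (B (inv ?g) * D h)"
        by (rule mult_add_distrib_mat[of _ k k _ l]) (use c(1)[of "inv ?g"] c(1)[of ?g] c(2)[of h] c(2)[of "inv ?g"] c(3)[of h] in auto)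
      also have "A ?g * (A (inv ?g) * B h) = (A ?g * A (inv ?g)) * B h"
        by (rule assoc_mult_mat[OF c(1) c(1) c(2), symmetric])
      also have "A ?g * A (inv ?g) = 1\<^sub>m k"
        using rep_inv(2)[OF rA(1) gc(1)] rA(2) by simp
      also have "1\<^sub>m k * B h = B h" by (rule left_mult_one_mat[OF c(2)])
      also have "A ?g * (B (inv ?g) * D h) = A ?g * B (inv ?g) * D h"
        by (rule assoc_mult_mat[OF c(1) c(2) c(3), symmetric])
      finally show "A h * (A g * B (inv g)) = B h + A ?g * B (inv ?g) * D h" .
    qed
    also have "\<dots> = mat_sum k l (\<lambda>g. B h + A g * B (inv g) * D h) (carrier G)"
      by (simp add: mat_sum_def sum_translate[OF h, of "\<lambda>g. (B h + A g * B (inv g) * D h) $$ _"])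
    also have "\<dots> = ?N \<cdot>\<^sub>m B h + Z * D h"
    proof (rule eq_matI)
      have ZD: "Z * D h = mat_sum k l (\<lambda>g. A g * B (inv g) * D h) (carrier G)"
        unfolding Z_def by (rule mat_sum_mult[OF c(3) ABc])
      have ABDc: "A g * B g' * D h \<in> carrier_mat k l" for g g' using ABc[of g g'] c(3)[of h] by simp
      fix i j assume "i < dim_row (?N \<cdot>\<^sub>m B h + Z * D h)" "j < dim_col (?N \<cdot>\<^sub>m B h + Z * D h)"
      then have ij: "i < k" "j < l" using c(3)[of h] Zc by auto
      have "mat_sum k l (\<lambda>g. B h + A g * B (inv g) * D h) (carrier G) $$ (i, j)
          = (\<Sum>g\<in>carrier G. B h $$ (i, j) + (A g * B (inv g) * D h) $$ (i, j))"
        unfolding mat_sum_index[OF ij]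
        by (intro sum.cong refl index_add_mat(1)) (use ij carrier_matD[OF ABDc] in simp_all)
      also have "\<dots> = ?N * B h $$ (i, j) + (Z * D h) $$ (i, j)"
        unfolding ZD mat_sum_index[OF ij] by (simp add: sum.distrib)
      also have "\<dots> = (?N \<cdot>\<^sub>m B h + Z * D h) $$ (i, j)"
        using ij c(2)[of h] c(3)[of h] Zc by (simp del: index_mult_mat(1))
      finally show "mat_sum k l (\<lambda>g. B h + A g * B (inv g) * D h) (carrier G) $$ (i, j)
        = (?N \<cdot>\<^sub>m B h + Z * D h) $$ (i, j)" .
    qed (use Zc c(3)[of h] in auto)
    finally show ?thesis .
  qed
  define Y where "Y = (1 / ?N) \<cdot>\<^sub>m Z"
  have Yc: "Y \<in> carrier_mat k l" using Zc by (simp add: Y_def)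
  have Y: "A h * Y = B h + Y * D h" if h: "h \<in> carrier G" for h
  proof -
    have N0: "?N \<noteq> 0" using order_pos by auto
    have "A h * Y = (1 / ?N) \<cdot>\<^sub>m (A h * Z)"
      unfolding Y_def by (rule mult_smult_distrib[OF c(1) Zc])
    also have "\<dots> = (1 / ?N) \<cdot>\<^sub>m (?N \<cdot>\<^sub>m B h) + (1 / ?N) \<cdot>\<^sub>m (Z * D h)"
      unfolding Z[OF h] by (rule add_smult_distrib_left_mat[of _ k l]) (use c(2)[of h] c(3)[of h] Zc in auto)
    also have "(1 / ?N) \<cdot>\<^sub>m (?N \<cdot>\<^sub>m B h) = B h"
      by (rule eq_matI) (use N0 in auto)
    also have "(1 / ?N) \<cdot>\<^sub>m (Z * D h) = Y * D h"
      unfolding Y_def by (rule mult_smult_assoc_mat[OF Zc c(3), symmetric])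
    finally show ?thesis .
  qed
  let ?U = "four_block_mat (1\<^sub>m k) Y (0\<^sub>m l k) (1\<^sub>m l)" and ?U' = "four_block_mat (1\<^sub>m k) (- Y) (0\<^sub>m l k) (1\<^sub>m l)"
  have UU': "?U * ?U' = 1\<^sub>m (k + l)"
  proof -
    have "?U * ?U' = four_block_mat (1\<^sub>m k * 1\<^sub>m k + Y * 0\<^sub>m l k) (1\<^sub>m k * - Y + Y * 1\<^sub>m l)
        (0\<^sub>m l k * 1\<^sub>m k + 1\<^sub>m l * 0\<^sub>m l k) (0\<^sub>m l k * - Y + 1\<^sub>m l * 1\<^sub>m l)"
      by (rule mult_four_block_mat[OF one_carrier_mat Yc zero_carrier_mat one_carrier_mat
            one_carrier_mat uminus_carrier_mat[OF Yc] zero_carrier_mat one_carrier_mat])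
    also have "\<dots> = four_block_mat (1\<^sub>m k) (0\<^sub>m k l) (0\<^sub>m l k) (1\<^sub>m l)"
      unfolding left_mult_zero_mat[OF uminus_carrier_mat[OF Yc]]
      using Yc by (auto intro!: cong_four_block_mat)
    finally show ?thesis by simp
  qed
  then have U'U: "?U' * ?U = 1\<^sub>m (k + l)"
    by (rule mat_mult_left_right_inverse[rotated 2]) (use Yc in auto)
  have dims: "rep_dim G (block_rep A D) = k + l"
    using representation_block(2)[OF rA(1) rD(1)] rA(2) rD(2) by simp
  have "intertwiner \<rho> (block_rep A D) ?U"
    unfolding intertwiner_def dims dim
  proof (intro conjI ballI)
    fix g assume g: "g \<in> carrier G"
    have "?U * \<rho> g = four_block_mat (1\<^sub>m k * A g + Y * 0\<^sub>m l k) (1\<^sub>m k * B g + Y * D g)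
        (0\<^sub>m l k * A g + 1\<^sub>m l * 0\<^sub>m l k) (0\<^sub>m l k * B g + 1\<^sub>m l * D g)"
      unfolding fb[OF g]
      by (rule mult_four_block_mat[OF one_carrier_mat Yc zero_carrier_mat one_carrier_mat
            c(1) c(2) zero_carrier_mat c(3)])
    also have "\<dots> = four_block_mat (A g) (A g * Y) (0\<^sub>m l k) (D g)"
      using Yc c(1)[of g] c(2)[of g] c(3)[of g] by (simp add: Y[OF g])
    also have "\<dots> = four_block_mat (A g * 1\<^sub>m k + 0\<^sub>m k l * 0\<^sub>m l k) (A g * Y + 0\<^sub>m k l * 1\<^sub>m l)
        (0\<^sub>m l k * 1\<^sub>m k + D g * 0\<^sub>m l k) (0\<^sub>m l k * Y + D g * 1\<^sub>m l)"
      using Yc c(1)[of g] c(3)[of g] by simp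
    also have "\<dots> = four_block_mat (A g) (0\<^sub>m k l) (0\<^sub>m l k) (D g) * ?U"
      by (rule mult_four_block_mat[symmetric, OF c(1) zero_carrier_mat zero_carrier_mat c(3)
            one_carrier_mat Yc zero_carrier_mat one_carrier_mat])
    also have "four_block_mat (A g) (0\<^sub>m k l) (0\<^sub>m l k) (D g) = block_rep A D g"
      using block_rep_eq[OF rA(1) rD(1) g] rA(2) rD(2) by simp
    finally show "?U * \<rho> g = block_rep A D g * ?U" .
  qed (use Yc in auto)
  then show "rep_iso G \<rho> (block_rep A D)"
    by (rule rep_isoI[where T'="?U'"]) (use Yc UU' U'U in \<open>simp_all add: dims dim\<close>)
qed

text \<open>In a basis adapted to an invariant subspace all matrices of the representation become block
triangular.\<close>

lemma reducible_splits:
  assumes rep: "representation G \<rho>" and pos: "rep_dim G \<rho> > 0" and red: "\<not> irreducible_rep G \<rho>"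
  shows "\<exists>A D. representation G A \<and> representation G D \<and> rep_dim G A < rep_dim G \<rho> \<and>
    rep_dim G D < rep_dim G \<rho> \<and> rep_iso G \<rho> (block_rep A D)"
proof -
  define n where "n = rep_dim G \<rho>"
  from red rep pos obtain W where sub: "VectorSpace.subspace class_ring W (module_vec TYPE(complex) n)"
    and inv: "\<And>g w. g \<in> carrier G \<Longrightarrow> w \<in> W \<Longrightarrow> \<rho> g *\<^sub>v w \<in> W"
    and W: "W \<noteq> {0\<^sub>v n}" "W \<noteq> carrier_vec n"
    by (auto simp: irreducible_rep_def n_def)
  obtain S S' k where S: "S \<in> carrier_mat n n" "S' \<in> carrier_mat n n" "S * S' = 1\<^sub>m n" "S' * S = 1\<^sub>m n"
    "0 < k" "k < n" "\<And>j. j < k \<Longrightarrow> col S j \<in> W"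
    "\<And>w i. w \<in> W \<Longrightarrow> k \<le> i \<Longrightarrow> i < n \<Longrightarrow> (S' *\<^sub>v w) $ i = 0"
    by (rule adapted_basis_proper[OF sub W]) blast
  have c: "\<rho> g \<in> carrier_mat n n" if "g \<in> carrier G" for g
    using rep_carrier[OF rep that] by (simp add: n_def)
  note assoc = assoc_mult_mat[of _ n n _ n _ n]
  define \<tau> where "\<tau> g = S' * \<rho> g * S" for g
  have \<tau>c: "\<tau> g \<in> carrier_mat n n" if "g \<in> carrier G" for g using c[OF that] S by (simp add: \<tau>_def)
  have \<tau>1: "\<tau> \<one> = 1\<^sub>m n" using rep_one[OF rep] S by (simp add: \<tau>_def n_def[symmetric])
  have \<tau>m: "\<tau> (g \<otimes> h) = \<tau> g * \<tau> h" if g: "g \<in> carrier G" and h: "h \<in> carrier G" for g h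
  proof -
    have "\<tau> g * \<tau> h = S' * (\<rho> g * ((S * S') * (\<rho> h * S)))"
      using S(1,2) c[OF g] c[OF h] by (simp add: \<tau>_def assoc)
    also have "\<dots> = \<tau> (g \<otimes> h)"
      using S(1-3) c[OF g] c[OF h] by (simp add: \<tau>_def assoc rep_mult[OF rep g h])
    finally show ?thesis by simp
  qed
  have \<tau>: "representation G \<tau>" "rep_dim G \<tau> = n" using representationI[of \<tau> n] \<tau>c \<tau>1 \<tau>m by auto
  have "intertwiner \<rho> \<tau> S'"
    unfolding intertwiner_def
  proof (intro conjI ballI)
    fix g assume g: "g \<in> carrier G"
    have "\<tau> g * S' = S' * (\<rho> g * (S * S'))" using S(1,2) c[OF g] by (simp add: \<tau>_def assoc)
    then show "S' * \<rho> g = \<tau> g * S'" using S(3) c[OF g] by simp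
  qed (use S \<tau>(2) in \<open>simp add: n_def\<close>)
  then have iso1: "rep_iso G \<rho> \<tau>"
    by (rule rep_isoI[where T'=S]) (use S \<tau>(2) in \<open>simp_all add: n_def\<close>)
  define l where "l = n - k"
  have n: "n = k + l" and l: "l < n" using S(5,6) by (simp_all add: l_def)
  have low: "\<tau> g $$ (i, j) = 0" if g: "g \<in> carrier G" and ij: "k \<le> i" "i < n" "j < k" for g i j
  proof -
    have jn: "j < n" using ij S(6) by simp
    have "\<tau> g $$ (i, j) = col (\<tau> g) j $ i" using \<tau>c[OF g] ij jn by simp
    also have "col (\<tau> g) j = col (S' * (\<rho> g * S)) j"
      using S(1,2) c[OF g] by (simp only: \<tau>_def assoc_mult_mat)
    also have "\<dots> = S' *\<^sub>v (\<rho> g *\<^sub>v col S j)"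
      using col_mult2[OF S(2) mult_carrier_mat[OF c[OF g] S(1)] jn] col_mult2[OF c[OF g] S(1) jn] by simp
    also have "\<dots> $ i = 0" using S(8)[OF inv[OF g S(7)]] ij by simp
    finally show ?thesis .
  qed
  define A where "A g = mat k k (\<lambda>(i, j). \<tau> g $$ (i, j))" for g
  define B where "B g = mat k l (\<lambda>(i, j). \<tau> g $$ (i, j + k))" for g
  define D where "D g = mat l l (\<lambda>(i, j). \<tau> g $$ (i + k, j + k))" for g
  have ABD: "A g \<in> carrier_mat k k" "B g \<in> carrier_mat k l" "D g \<in> carrier_mat l l" for g
    by (simp_all add: A_def B_def D_def)
  have fb: "\<tau> g = four_block_mat (A g) (B g) (0\<^sub>m l k) (D g)" if g: "g \<in> carrier G" for g
    by (rule eq_matI) (use \<tau>c[OF g] low[OF g] n in \<open>auto simp: A_def B_def D_def\<close>)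
  note sp = block_triangular_splits[OF \<tau>(1) \<tau>(2)[unfolded n] fb ABD]
  have "rep_iso G \<rho> (block_rep A D)"
    by (rule rep_iso_trans[OF rep \<tau>(1) representation_block(1)[OF sp(1,3)] iso1 sp(5)])
  then show ?thesis using sp(1-4) S(6) l by (auto simp: n_def)
qed

text \<open>Split repeatedly; both summands have smaller dimension.\<close>

theorem maschke:
  assumes "representation G \<rho>"
  shows "\<exists>\<sigma>s. (\<forall>\<sigma>\<in>set \<sigma>s. irreducible_rep G \<sigma>) \<and> rep_iso G \<rho> (direct_sum_rep \<sigma>s)"
  using assms
proof (induction "rep_dim G \<rho>" arbitrary: \<rho> rule: less_induct)
  case less
  note rep = \<open>representation G \<rho>\<close>
  consider "rep_dim G \<rho> = 0" | "irreducible_rep G \<rho>" | "rep_dim G \<rho> > 0" "\<not> irreducible_rep G \<rho>" by blast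
  then show ?case
  proof cases
    case 1
    have "rep_iso G \<rho> (direct_sum_rep [])"
    proof (rule rep_isoI[where T="0\<^sub>m 0 0" and T'="0\<^sub>m 0 0"])
      have d: "rep_dim G (direct_sum_rep [] :: 'a rep) = 0" by (simp add: direct_sum_rep_Nil rep_dim_def)
      show "intertwiner \<rho> (direct_sum_rep []) (0\<^sub>m 0 0)"
        unfolding intertwiner_def d 1
        by (auto simp: direct_sum_rep_Nil carrier_matD(2)[OF rep_carrier[OF rep]] 1 intro!: eq_matI)
      show "0\<^sub>m 0 0 * 0\<^sub>m 0 0 = (1\<^sub>m (rep_dim G (direct_sum_rep [] :: 'a rep)) :: complex mat)"
        by (auto simp: d intro!: eq_matI)
      show "0\<^sub>m 0 0 * 0\<^sub>m 0 0 = (1\<^sub>m (rep_dim G \<rho>) :: complex mat)" by (auto simp: 1 intro!: eq_matI)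
      show "0\<^sub>m 0 0 \<in> carrier_mat (rep_dim G \<rho>) (rep_dim G (direct_sum_rep [] :: 'a rep))"
        by (simp add: d 1)
    qed
    then show ?thesis by (intro exI[of _ "[]"]) simp
  next
    case 2
    then show ?thesis
      using rep_iso_refl[OF rep] by (intro exI[of _ "[\<rho>]"]) (simp add: direct_sum_rep_single)
  next
    case 3
    from reducible_splits[OF rep 3] obtain A D where r: "representation G A" "representation G D"
      and d: "rep_dim G A < rep_dim G \<rho>" "rep_dim G D < rep_dim G \<rho>"
      and iso: "rep_iso G \<rho> (block_rep A D)" by blast
    from less.hyps[OF d(1) r(1)] obtain \<sigma>s where s: "\<forall>\<sigma>\<in>set \<sigma>s. irreducible_rep G \<sigma>" "rep_iso G A (direct_sum_rep \<sigma>s)"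
      by blast
    from less.hyps[OF d(2) r(2)] obtain \<tau>s where t: "\<forall>\<sigma>\<in>set \<tau>s. irreducible_rep G \<sigma>" "rep_iso G D (direct_sum_rep \<tau>s)"
      by blast
    have rs: "representation G (direct_sum_rep \<sigma>s)" "representation G (direct_sum_rep \<tau>s)"
      using s(1) t(1) irr_rep by (auto intro!: representation_direct_sum)
    have "rep_iso G (block_rep A D) (direct_sum_rep (\<sigma>s @ \<tau>s))"
      unfolding direct_sum_rep_append by (rule rep_iso_block[OF r rs s(2) t(2)])
    then have "rep_iso G \<rho> (direct_sum_rep (\<sigma>s @ \<tau>s))"
      using rep_iso_trans[OF rep representation_block(1)[OF r] _ iso] representation_block(1)[OF rs]
      by (simp add: direct_sum_rep_append)
    then show ?thesis using s(1) t(1) by (intro exI[of _ "\<sigma>s @ \<tau>s"]) auto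
  qed
qed

end

section \<open>Tensor products\<close>

text \<open>Kronecker products index pairs \<open>(i, j)\<close> by \<open>i * n + j\<close>.\<close>

lemma sum_div_mod:
  fixes f :: "nat \<Rightarrow> nat \<Rightarrow> 'a::comm_monoid_add"
  shows "(\<Sum>k<m * n. f (k div n) (k mod n)) = (\<Sum>i<m. \<Sum>j<n. f i j)"
proof (induction m)
  case (Suc m)
  have "(\<Sum>k<Suc m * n. f (k div n) (k mod n))
      = (\<Sum>k<m * n. f (k div n) (k mod n)) + (\<Sum>j<n. f ((m * n + j) div n) ((m * n + j) mod n))"
    by (simp only: mult_Suc add.commute[of n] sum_lessThan_add)
  also have "(\<Sum>j<n. f ((m * n + j) div n) ((m * n + j) mod n)) = (\<Sum>j<n. f m j)"
    by (rule sum.cong) auto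
  finally show ?case using Suc by simp
qed simp

lemma kronecker_carrier [simp]:
  "A \<in> carrier_mat a b \<Longrightarrow> B \<in> carrier_mat c d \<Longrightarrow> kronecker A B \<in> carrier_mat (a * c) (b * d)"
  by (auto simp: kronecker_def)

lemma kronecker_index:
  assumes "A \<in> carrier_mat a b" "B \<in> carrier_mat c d" "i < a * c" "j < b * d"
  shows "kronecker A B $$ (i, j) = A $$ (i div c, j div d) * B $$ (i mod c, j mod d)"
  using assms by (auto simp: kronecker_def)

lemma kronecker_one: "kronecker (1\<^sub>m m) (1\<^sub>m n) = 1\<^sub>m (m * n)"
proof (rule eq_matI)
  fix i j assume "i < dim_row (1\<^sub>m (m * n) :: complex mat)" "j < dim_col (1\<^sub>m (m * n) :: complex mat)"
  then have ij: "i < m * n" "j < m * n" by auto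
  then have "n > 0" by (cases n) auto
  then have b: "i div n < m" "j div n < m" "i mod n < n" "j mod n < n"
    using ij by (auto intro: less_mult_imp_div_less)
  have "i = j \<longleftrightarrow> i div n = j div n \<and> i mod n = j mod n"
    by (metis div_mult_mod_eq)
  then show "kronecker (1\<^sub>m m) (1\<^sub>m n) $$ (i, j) = 1\<^sub>m (m * n) $$ (i, j)"
    using ij b by (simp add: kronecker_index[OF one_carrier_mat one_carrier_mat])
qed (simp_all add: kronecker_def)

lemma kronecker_mult:
  assumes A: "A \<in> carrier_mat m m" "A' \<in> carrier_mat m m" and B: "B \<in> carrier_mat n n" "B' \<in> carrier_mat n n"
  shows "kronecker (A * A') (B * B') = kronecker A B * kronecker A' B'"
proof (rule eq_matI)
  have c: "kronecker A B \<in> carrier_mat (m * n) (m * n)" "kronecker A' B' \<in> carrier_mat (m * n) (m * n)"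
    using assms by auto
  fix i j assume "i < dim_row (kronecker A B * kronecker A' B')" "j < dim_col (kronecker A B * kronecker A' B')"
  then have ij: "i < m * n" "j < m * n" using c by auto
  then have "n > 0" by (cases n) auto
  then have b: "i div n < m" "j div n < m" "i mod n < n" "j mod n < n"
    using ij by (auto intro: less_mult_imp_div_less)
  have "kronecker (A * A') (B * B') $$ (i, j) = (A * A') $$ (i div n, j div n) * (B * B') $$ (i mod n, j mod n)"
    by (rule kronecker_index[where a=m and b=m]) (use assms ij in auto)
  also have "\<dots> = (\<Sum>k<m. \<Sum>l<n. (A $$ (i div n, k) * A' $$ (k, j div n)) * (B $$ (i mod n, l) * B' $$ (l, j mod n)))"
    unfolding mult_mat_entry[OF A b(1,2)] mult_mat_entry[OF B b(3,4)] by (rule sum_product)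
  also have "\<dots> = (\<Sum>k<m * n. (A $$ (i div n, k div n) * A' $$ (k div n, j div n)) * (B $$ (i mod n, k mod n) * B' $$ (k mod n, j mod n)))"
    by (rule sum_div_mod[symmetric])
  also have "\<dots> = (\<Sum>k<m * n. kronecker A B $$ (i, k) * kronecker A' B' $$ (k, j))"
    by (rule sum.cong[OF refl])
      (use ij in \<open>simp add: kronecker_index[OF A(1) B(1)] kronecker_index[OF A(2) B(2)] mult_ac\<close>)
  also have "\<dots> = (kronecker A B * kronecker A' B') $$ (i, j)"
    by (rule mult_mat_entry[symmetric, OF c ij])
  finally show "kronecker (A * A') (B * B') $$ (i, j) = (kronecker A B * kronecker A' B') $$ (i, j)" .
qed (use assms in \<open>simp_all add: kronecker_def\<close>)

lemma mtrace_kronecker: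
  assumes "A \<in> carrier_mat m m" "B \<in> carrier_mat n n"
  shows "mtrace (kronecker A B) = mtrace A * mtrace B"
proof -
  have "mtrace (kronecker A B) = (\<Sum>k<m * n. A $$ (k div n, k div n) * B $$ (k mod n, k mod n))"
    using assms by (auto simp: mtrace_def kronecker_def intro!: sum.cong)
  also have "\<dots> = (\<Sum>i<m. \<Sum>j<n. A $$ (i, i) * B $$ (j, j))"
    by (rule sum_div_mod)
  also have "\<dots> = mtrace A * mtrace B"
    using assms by (simp add: mtrace_def sum_product)
  finally show ?thesis .
qed

primrec tensor_power :: "'g rep \<Rightarrow> nat \<Rightarrow> 'g rep" where
  "tensor_power \<eta> 0 = (\<lambda>g. 1\<^sub>m 1)"
| "tensor_power \<eta> (Suc r) = tensor_rep (tensor_power \<eta> r) \<eta>"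

context finite_group
begin

lemma representation_tensor:
  assumes "representation G \<rho>" "representation G \<sigma>"
  shows "representation G (tensor_rep \<rho> \<sigma>)" "rep_dim G (tensor_rep \<rho> \<sigma>) = rep_dim G \<rho> * rep_dim G \<sigma>"
proof -
  have "tensor_rep \<rho> \<sigma> g \<in> carrier_mat (rep_dim G \<rho> * rep_dim G \<sigma>) (rep_dim G \<rho> * rep_dim G \<sigma>)"
    if "g \<in> carrier G" for g
    using rep_carrier[OF assms(1) that] rep_carrier[OF assms(2) that] by (simp add: tensor_rep_def)
  moreover have "tensor_rep \<rho> \<sigma> \<one> = 1\<^sub>m (rep_dim G \<rho> * rep_dim G \<sigma>)"
    using assms by (simp add: tensor_rep_def rep_one kronecker_one)
  moreover have "tensor_rep \<rho> \<sigma> (g \<otimes> h) = tensor_rep \<rho> \<sigma> g * tensor_rep \<rho> \<sigma> h"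
    if "g \<in> carrier G" "h \<in> carrier G" for g h
    using that assms by (simp add: tensor_rep_def rep_mult
        kronecker_mult[OF rep_carrier[OF assms(1)] rep_carrier[OF assms(1)] rep_carrier[OF assms(2)] rep_carrier[OF assms(2)]])
  ultimately show "representation G (tensor_rep \<rho> \<sigma>)" "rep_dim G (tensor_rep \<rho> \<sigma>) = rep_dim G \<rho> * rep_dim G \<sigma>"
    using representationI[of "tensor_rep \<rho> \<sigma>"] by blast+
qed

lemma character_tensor:
  assumes "representation G \<rho>" "representation G \<sigma>" "g \<in> carrier G"
  shows "character (tensor_rep \<rho> \<sigma>) g = character \<rho> g * character \<sigma> g"
  unfolding character_def tensor_rep_def
  by (rule mtrace_kronecker[OF rep_carrier[OF assms(1,3)] rep_carrier[OF assms(2,3)]])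

lemma representation_trivial: "representation G (\<lambda>g. 1\<^sub>m 1)" "rep_dim G (\<lambda>g. 1\<^sub>m 1) = 1"
  using representationI[of "\<lambda>g. 1\<^sub>m 1" 1] by auto

lemma representation_tensor_power:
  assumes "representation G \<eta>"
  shows "representation G (tensor_power \<eta> r)"
  by (induction r) (use assms representation_trivial in \<open>simp_all add: representation_tensor\<close>)

lemma character_tensor_power:
  assumes "representation G \<eta>" "g \<in> carrier G"
  shows "character (tensor_power \<eta> r) g = character \<eta> g ^ r"
proof (induction r)
  case 0
  show ?case by (simp add: character_def)
next
  case (Suc r)
  then show ?case
    using character_tensor[OF representation_tensor_power[OF assms(1), of r] assms] by simp
qed

text \<open>It provides the trivial representation, whose multiplicity in a restriction makes character sums over
subgroups natural numbers, and the sign representation, which attains the minimum.\<close>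

lemma one_dim_irreducible:
  assumes "representation G \<rho>" "rep_dim G \<rho> = 1"
  shows "irreducible_rep G \<rho>"
  unfolding irreducible_rep_def assms(2)
proof (intro conjI allI impI)
  fix W assume "VectorSpace.subspace class_ring W (module_vec TYPE(complex) 1) \<and> (\<forall>g\<in>carrier G. \<forall>w\<in>W. \<rho> g *\<^sub>v w \<in> W)"
  then have "VectorSpace.subspace class_ring W (module_vec TYPE(complex) 1)" by simp
  note W = subspace_vecD[OF this]
  show "W = {0\<^sub>v 1} \<or> W = carrier_vec 1"
  proof (rule disjCI)
    assume "W \<noteq> carrier_vec 1"
    then obtain v where v: "v \<in> carrier_vec 1" "v \<notin> W" using W(1) by blast
    have "w = 0\<^sub>v 1" if w: "w \<in> W" for w
    proof (rule ccontr)
      assume "w \<noteq> 0\<^sub>v 1"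
      have wc: "w \<in> carrier_vec 1" using w W(1) by blast
      have "w $ 0 \<noteq> 0"
      proof
        assume "w $ 0 = 0"
        then have "w = 0\<^sub>v 1" by (intro eq_vecI) (use wc in auto)
        with \<open>w \<noteq> 0\<^sub>v 1\<close> show False by simp
      qed
      then have "v = (v $ 0 / w $ 0) \<cdot>\<^sub>v w" by (intro eq_vecI) (use wc v in auto)
      with W(4)[OF w, of "v $ 0 / w $ 0"] v(2) show False by simp
    qed
    with W(2) show "W = {0\<^sub>v 1}" by blast
  qed
qed (use assms in auto)

lemma trivial_irreducible: "irreducible_rep G (\<lambda>g. 1\<^sub>m 1)"
  by (rule one_dim_irreducible) (rule representation_trivial)+

section \<open>Multiplicities and isomorphism classes of irreducible representations\<close>

lemma char_inner_cong:
  "(\<And>g. g \<in> carrier G \<Longrightarrow> \<psi> g = \<psi>' g) \<Longrightarrow> char_inner \<phi> \<psi> = char_inner \<phi> \<psi>'"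
  by (simp add: char_inner_def cong: sum.cong)

lemma char_inner_direct_sum:
  assumes \<rho>: "irreducible_rep G \<rho>" and \<sigma>s: "\<And>\<sigma>. \<sigma> \<in> set \<sigma>s \<Longrightarrow> irreducible_rep G \<sigma>"
  shows "char_inner (character \<rho>) (\<lambda>g. \<Sum>\<sigma>\<leftarrow>\<sigma>s. character \<sigma> g)
    = of_nat (length (filter (\<lambda>\<sigma>. rep_iso G \<rho> \<sigma>) \<sigma>s))"
  using \<sigma>s
proof (induction \<sigma>s)
  case (Cons \<sigma> \<sigma>s)
  have "char_inner (character \<rho>) (\<lambda>g. \<Sum>\<sigma>\<leftarrow>\<sigma> # \<sigma>s. character \<sigma> g)
      = char_inner (character \<rho>) (character \<sigma>) + char_inner (character \<rho>) (\<lambda>g. \<Sum>\<sigma>\<leftarrow>\<sigma>s. character \<sigma> g)"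
    by (simp add: char_inner_def distrib_left sum.distrib add_divide_distrib)
  then show ?case using Cons char_orthogonal[OF \<rho>, of \<sigma>] by simp
qed (simp add: char_inner_def)

text \<open>The right-hand side does not mention the decomposition. This is why the definite description in
\<open>multiplicity_rep\<close> denotes.\<close>

lemma multiplicity_decomposition:
  assumes \<rho>: "irreducible_rep G \<rho>" and V: "representation G V"
    and \<sigma>s: "\<And>\<sigma>. \<sigma> \<in> set \<sigma>s \<Longrightarrow> irreducible_rep G \<sigma>" and iso: "rep_iso G V (direct_sum_rep \<sigma>s)"
  shows "of_nat (length (filter (\<lambda>\<sigma>. rep_iso G \<rho> \<sigma>) \<sigma>s)) = char_inner (character \<rho>) (character V)"
proof -
  have r: "\<And>\<sigma>. \<sigma> \<in> set \<sigma>s \<Longrightarrow> representation G \<sigma>" using \<sigma>s irr_rep by blast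
  have "char_inner (character \<rho>) (character V) = char_inner (character \<rho>) (\<lambda>g. \<Sum>\<sigma>\<leftarrow>\<sigma>s. character \<sigma> g)"
    using character_iso[OF V representation_direct_sum[OF r] iso] character_direct_sum[OF r]
    by (intro char_inner_cong) simp
  then show ?thesis using char_inner_direct_sum[OF \<rho> \<sigma>s] by simp
qed

lemma multiplicity_eq_length:
  assumes \<rho>: "irreducible_rep G \<rho>" and V: "representation G V"
    and \<sigma>s: "\<And>\<sigma>. \<sigma> \<in> set \<sigma>s \<Longrightarrow> irreducible_rep G \<sigma>" and iso: "rep_iso G V (direct_sum_rep \<sigma>s)"
  shows "multiplicity_rep G \<rho> V = length (filter (\<lambda>\<sigma>. rep_iso G \<rho> \<sigma>) \<sigma>s)"
  unfolding multiplicity_rep_def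
proof (rule the_equality)
  fix m assume "\<exists>\<tau>s. (\<forall>\<sigma>\<in>set \<tau>s. irreducible_rep G \<sigma>) \<and> rep_iso G V (direct_sum_rep \<tau>s) \<and>
      m = length (filter (\<lambda>\<sigma>. rep_iso G \<rho> \<sigma>) \<tau>s)"
  then obtain \<tau>s where "\<forall>\<sigma>\<in>set \<tau>s. irreducible_rep G \<sigma>" "rep_iso G V (direct_sum_rep \<tau>s)"
    and m: "m = length (filter (\<lambda>\<sigma>. rep_iso G \<rho> \<sigma>) \<tau>s)" by blast
  then have "(of_nat m :: complex) = char_inner (character \<rho>) (character V)"
    unfolding m by (intro multiplicity_decomposition[OF \<rho> V]) auto
  also have "\<dots> = of_nat (length (filter (\<lambda>\<sigma>. rep_iso G \<rho> \<sigma>) \<sigma>s))"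
    by (rule multiplicity_decomposition[OF \<rho> V \<sigma>s iso, symmetric])
  finally show "m = length (filter (\<lambda>\<sigma>. rep_iso G \<rho> \<sigma>) \<sigma>s)" by (simp only: of_nat_eq_iff)
qed (use \<sigma>s iso in blast)

theorem multiplicity_char_inner:
  assumes "irreducible_rep G \<rho>" "representation G V"
  shows "of_nat (multiplicity_rep G \<rho> V) = char_inner (character \<rho>) (character V)"
proof -
  obtain \<sigma>s where "\<forall>\<sigma>\<in>set \<sigma>s. irreducible_rep G \<sigma>" "rep_iso G V (direct_sum_rep \<sigma>s)"
    using maschke[OF assms(2)] by blast
  then show ?thesis
    using multiplicity_eq_length[OF assms, of \<sigma>s] multiplicity_decomposition[OF assms, of \<sigma>s] by simp
qed

text \<open>Isomorphism of irreducible representations thereby inherits symmetry and transitivity from equality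
of characters.\<close>

lemma irr_iso_iff_character:
  assumes "irreducible_rep G \<rho>" "irreducible_rep G \<sigma>"
  shows "rep_iso G \<rho> \<sigma> \<longleftrightarrow> (\<forall>g\<in>carrier G. character \<rho> g = character \<sigma> g)"
proof
  assume "rep_iso G \<rho> \<sigma>"
  then show "\<forall>g\<in>carrier G. character \<rho> g = character \<sigma> g"
    using character_iso[OF assms[THEN irr_rep]] by simp
next
  assume "\<forall>g\<in>carrier G. character \<rho> g = character \<sigma> g"
  then have "char_inner (character \<rho>) (character \<sigma>) = char_inner (character \<rho>) (character \<rho>)"
    by (intro char_inner_cong) simp
  also have "\<dots> = 1" using char_orthogonal[OF assms(1,1)] rep_iso_refl[OF irr_rep[OF assms(1)]] by simp
  finally show "rep_iso G \<rho> \<sigma>" using char_orthogonal[OF assms] by (auto split: if_splits)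
qed

lemma equiv_irr_iso_rel: "equiv {\<rho>. irreducible_rep G \<rho>} (irr_iso_rel G)"
  by (rule equivI) (auto simp: irr_iso_rel_def refl_on_def sym_def trans_def irr_iso_iff_character)

definition irr_class :: "'a rep \<Rightarrow> 'a rep set" where
  "irr_class \<rho> = irr_iso_rel G `` {\<rho>}"

lemma irr_class_in_Irr: "irreducible_rep G \<rho> \<Longrightarrow> irr_class \<rho> \<in> Irr G"
  by (auto simp: Irr_def irr_class_def intro: quotientI)

lemma irr_class_eq_iff:
  "irreducible_rep G \<rho> \<Longrightarrow> irreducible_rep G \<sigma> \<Longrightarrow> irr_class \<rho> = irr_class \<sigma> \<longleftrightarrow> rep_iso G \<rho> \<sigma>"
  using eq_equiv_class_iff[OF equiv_irr_iso_rel, of \<rho> \<sigma>] by (auto simp: irr_class_def irr_iso_rel_def)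

lemma representative_in_class:
  assumes "\<alpha> \<in> Irr G"
  shows "irreducible_rep G (representative \<alpha>)" "irr_class (representative \<alpha>) = \<alpha>"
proof -
  from assms obtain \<rho> where \<rho>: "irreducible_rep G \<rho>" "\<alpha> = irr_class \<rho>"
    by (auto simp: Irr_def irr_class_def elim: quotientE)
  have "\<rho> \<in> \<alpha>" using \<rho> rep_iso_refl[OF irr_rep] by (auto simp: irr_class_def irr_iso_rel_def)
  then have "representative \<alpha> \<in> \<alpha>" unfolding representative_def by (rule someI[of "\<lambda>\<rho>. \<rho> \<in> \<alpha>"])
  then have "irreducible_rep G (representative \<alpha>)" "rep_iso G \<rho> (representative \<alpha>)"
    using \<rho> by (auto simp: irr_class_def irr_iso_rel_def)
  then show "irreducible_rep G (representative \<alpha>)" "irr_class (representative \<alpha>) = \<alpha>"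
    using irr_class_eq_iff[OF \<rho>(1), of "representative \<alpha>"] \<rho>(2) by simp_all
qed

lemma representative_iso_iff:
  assumes "\<alpha> \<in> Irr G" "irreducible_rep G \<sigma>"
  shows "rep_iso G (representative \<alpha>) \<sigma> \<longleftrightarrow> \<alpha> = irr_class \<sigma>"
  using irr_class_eq_iff[OF representative_in_class(1)[OF assms(1)] assms(2)] representative_in_class(2)[OF assms(1)] by simp

lemma character_representative:
  assumes "irreducible_rep G \<sigma>" "g \<in> carrier G"
  shows "character (representative (irr_class \<sigma>)) g = character \<sigma> g"
  using representative_iso_iff[OF irr_class_in_Irr[OF assms(1)] assms(1)]
    irr_iso_iff_character[OF representative_in_class(1)[OF irr_class_in_Irr[OF assms(1)]] assms(1)] assms(2) by simp

lemma irr_dim_positive: "\<alpha> \<in> Irr G \<Longrightarrow> irr_dim G \<alpha> > 0"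
  using irr_dim_pos[OF representative_in_class(1)] by (simp add: irr_dim_def)

lemma character_representative_one: "\<alpha> \<in> Irr G \<Longrightarrow> character (representative \<alpha>) \<one> = of_nat (irr_dim G \<alpha>)"
  using character_one[OF irr_rep[OF representative_in_class(1)]] by (simp add: irr_dim_def)

section \<open>The Markov chain of a representation\<close>

text \<open>A decomposition of \<open>V\<close> has finitely many summands, and every irreducible representation is isomorphic to
one of them.\<close>

lemma finite_Irr:
  assumes V: "representation G V" and all: "\<And>\<rho>. irreducible_rep G \<rho> \<Longrightarrow> multiplicity_rep G \<rho> V > 0"
  shows "finite (Irr G)"
proof -
  obtain \<sigma>s where \<sigma>s: "\<forall>\<sigma>\<in>set \<sigma>s. irreducible_rep G \<sigma>" "rep_iso G V (direct_sum_rep \<sigma>s)"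
    using maschke[OF V] by blast
  have "Irr G \<subseteq> irr_class ` set \<sigma>s"
  proof
    fix \<alpha> assume \<alpha>: "\<alpha> \<in> Irr G"
    have "length (filter (\<lambda>\<sigma>. rep_iso G (representative \<alpha>) \<sigma>) \<sigma>s) > 0"
      using all[OF representative_in_class(1)[OF \<alpha>]] multiplicity_eq_length[OF representative_in_class(1)[OF \<alpha>] V _ \<sigma>s(2)] \<sigma>s(1)
      by simp
    then have "filter (\<lambda>\<sigma>. rep_iso G (representative \<alpha>) \<sigma>) \<sigma>s \<noteq> []" by simp
    then obtain \<sigma> where "\<sigma> \<in> set \<sigma>s" "rep_iso G (representative \<alpha>) \<sigma>"
      unfolding filter_empty_conv by blast
    then show "\<alpha> \<in> irr_class ` set \<sigma>s"
      using representative_iso_iff[OF \<alpha>] \<sigma>s(1) by blast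
  qed
  then show ?thesis by (rule finite_subset) simp
qed

lemma character_decomposition:
  assumes V: "representation G V" and fin: "finite (Irr G)" and g: "g \<in> carrier G"
  shows "character V g = (\<Sum>\<alpha>\<in>Irr G. of_nat (multiplicity_rep G (representative \<alpha>) V) * character (representative \<alpha>) g)"
proof -
  obtain \<sigma>s where \<sigma>s: "\<forall>\<sigma>\<in>set \<sigma>s. irreducible_rep G \<sigma>" "rep_iso G V (direct_sum_rep \<sigma>s)"
    using maschke[OF V] by blast
  have r: "\<And>\<sigma>. \<sigma> \<in> set \<sigma>s \<Longrightarrow> representation G \<sigma>" using \<sigma>s(1) irr_rep by blast
  have "character V g = (\<Sum>\<sigma>\<leftarrow>\<sigma>s. character \<sigma> g)"
    using character_iso[OF V representation_direct_sum[OF r] \<sigma>s(2) g] character_direct_sum[OF r g] by simp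
  also have "\<dots> = (\<Sum>\<alpha>\<in>Irr G. of_nat (length (filter (\<lambda>\<sigma>. rep_iso G (representative \<alpha>) \<sigma>) \<sigma>s)) * character (representative \<alpha>) g)"
    using \<sigma>s(1)
  proof (induction \<sigma>s)
    case (Cons \<sigma> \<sigma>s)
    then have \<sigma>: "irreducible_rep G \<sigma>" by simp
    have "(\<Sum>\<alpha>\<in>Irr G. of_nat (length (filter (\<lambda>\<sigma>. rep_iso G (representative \<alpha>) \<sigma>) (\<sigma> # \<sigma>s))) * character (representative \<alpha>) g)
        = (\<Sum>\<alpha>\<in>Irr G. (if \<alpha> = irr_class \<sigma> then character (representative \<alpha>) g else 0)
            + of_nat (length (filter (\<lambda>\<sigma>. rep_iso G (representative \<alpha>) \<sigma>) \<sigma>s)) * character (representative \<alpha>) g)"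
      by (intro sum.cong refl) (simp add: representative_iso_iff \<sigma> algebra_simps)
    also have "\<dots> = character (representative (irr_class \<sigma>)) g + (\<Sum>\<sigma>\<leftarrow>\<sigma>s. character \<sigma> g)"
      using Cons fin irr_class_in_Irr[OF \<sigma>] by (simp add: sum.distrib)
    finally show ?case using character_representative[OF \<sigma> g] by simp
  qed simp
  also have "\<dots> = (\<Sum>\<alpha>\<in>Irr G. of_nat (multiplicity_rep G (representative \<alpha>) V) * character (representative \<alpha>) g)"
    by (intro sum.cong refl)
      (use multiplicity_eq_length[OF representative_in_class(1) V _ \<sigma>s(2)] \<sigma>s(1) in simp)
  finally show ?thesis .
qed

text \<open>Decompose \<open>V\<close> before tensoring. This is the recursion that the powers of the kernel satisfy.\<close>

lemma multiplicity_tensor_decomposition: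
  assumes V: "representation G V" and \<eta>: "representation G \<eta>" and fin: "finite (Irr G)"
    and \<rho>: "irreducible_rep G \<rho>"
  shows "multiplicity_rep G \<rho> (tensor_rep V \<eta>) =
    (\<Sum>\<alpha>\<in>Irr G. multiplicity_rep G (representative \<alpha>) V * multiplicity_rep G \<rho> (tensor_rep (representative \<alpha>) \<eta>))"
proof -
  let ?m = "\<lambda>\<alpha>. of_nat (multiplicity_rep G (representative \<alpha>) V) :: complex"
  have ch: "character (tensor_rep V \<eta>) g = (\<Sum>\<alpha>\<in>Irr G. ?m \<alpha> * character (tensor_rep (representative \<alpha>) \<eta>) g)"
    if g: "g \<in> carrier G" for g
    using character_tensor[OF V \<eta> g] character_decomposition[OF V fin g]
      character_tensor[OF irr_rep[OF representative_in_class(1)] \<eta> g]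
    by (simp add: sum_distrib_right mult.assoc cong: sum.cong)
  have "(of_nat (multiplicity_rep G \<rho> (tensor_rep V \<eta>)) :: complex)
      = char_inner (character \<rho>) (\<lambda>g. \<Sum>\<alpha>\<in>Irr G. ?m \<alpha> * character (tensor_rep (representative \<alpha>) \<eta>) g)"
    unfolding multiplicity_char_inner[OF \<rho> representation_tensor(1)[OF V \<eta>]]
    by (rule char_inner_cong) (rule ch)
  also have "\<dots> = (\<Sum>\<alpha>\<in>Irr G. ?m \<alpha> * char_inner (character \<rho>) (character (tensor_rep (representative \<alpha>) \<eta>)))"
    unfolding char_inner_def sum_distrib_left sum_divide_distrib
    by (subst sum.swap) (simp add: mult_ac)
  also have "\<dots> = (\<Sum>\<alpha>\<in>Irr G. ?m \<alpha> * of_nat (multiplicity_rep G \<rho> (tensor_rep (representative \<alpha>) \<eta>)))"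
    by (intro sum.cong refl)
      (simp add: multiplicity_char_inner[OF \<rho> representation_tensor(1)[OF irr_rep[OF representative_in_class(1)] \<eta>]])
  also have "\<dots> = of_nat (\<Sum>\<alpha>\<in>Irr G. multiplicity_rep G (representative \<alpha>) V * multiplicity_rep G \<rho> (tensor_rep (representative \<alpha>) \<eta>))"
    by simp
  finally show ?thesis by (simp only: of_nat_eq_iff)
qed

text \<open>Along a path the factors \<open>d\<close> of consecutive steps cancel. What remains is the sum over paths of
the products of multiplicities, which is the multiplicity in the tensor power.\<close>

theorem kernel_power_from_trivial:
  assumes \<eta>: "representation G \<eta>" "rep_dim G \<eta> > 0" and fin: "finite (Irr G)" and \<beta>: "\<beta> \<in> Irr G"
  shows "kernel_power (Irr G) (irr_kernel G \<eta>) r (trivial_irr G) \<beta> =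
    real (irr_dim G \<beta>) * real (multiplicity_rep G (representative \<beta>) (tensor_power \<eta> r)) / real (rep_dim G \<eta>) ^ r"
  using \<beta>
proof (induction r arbitrary: \<beta>)
  case 0
  have t: "trivial_irr G = irr_class (\<lambda>g. 1\<^sub>m 1)" by (simp add: trivial_irr_def irr_class_def)
  define T :: "'a rep" where "T = (\<lambda>g. 1\<^sub>m 1)"
  have T: "irreducible_rep G T" "trivial_irr G = irr_class T"
    using trivial_irreducible t by (simp_all add: T_def)
  have m: "multiplicity_rep G (representative \<beta>) T = (if \<beta> = trivial_irr G then 1 else 0)"
    using multiplicity_eq_length[OF representative_in_class(1)[OF 0] irr_rep[OF T(1)], of "[T]"]
      T(1) rep_iso_refl[OF irr_rep[OF T(1)]] representative_iso_iff[OF 0 T(1)]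
    by (simp add: direct_sum_rep_single T(2))
  have "irr_dim G \<beta> = 1" if "\<beta> = trivial_irr G"
  proof -
    have "(of_nat (irr_dim G \<beta>) :: complex) = character T \<one>"
      using character_representative_one[OF 0] character_representative[OF T(1) one_closed]
      by (simp add: that T(2))
    also have "\<dots> = of_nat 1" by (simp add: character_def T_def)
    finally show ?thesis by (simp only: of_nat_eq_iff)
  qed
  with m show ?case by (auto simp: T_def)
next
  case (Suc r)
  let ?V = "tensor_power \<eta> r" and ?n = "real (rep_dim G \<eta>)"
  note V = representation_tensor_power[OF \<eta>(1), of r]
  have "kernel_power (Irr G) (irr_kernel G \<eta>) (Suc r) (trivial_irr G) \<beta>
     = (\<Sum>\<alpha>\<in>Irr G. real (irr_dim G \<alpha>) * real (multiplicity_rep G (representative \<alpha>) ?V) / ?n ^ r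
         * (real (irr_dim G \<beta>) * real (multiplicity_rep G (representative \<beta>) (tensor_rep (representative \<alpha>) \<eta>))
           / (real (irr_dim G \<alpha>) * ?n)))"
    unfolding kernel_power.simps by (intro sum.cong refl) (simp only: Suc.IH irr_kernel_def)
  also have "\<dots> = (\<Sum>\<alpha>\<in>Irr G. real (irr_dim G \<beta>) / ?n ^ Suc r * (real (multiplicity_rep G (representative \<alpha>) ?V)
       * real (multiplicity_rep G (representative \<beta>) (tensor_rep (representative \<alpha>) \<eta>))))"
  proof (intro sum.cong refl)
    fix \<alpha> assume "\<alpha> \<in> Irr G"
    then have "irr_dim G \<alpha> \<noteq> 0" using irr_dim_positive[of \<alpha>] by simp
    then show "real (irr_dim G \<alpha>) * real (multiplicity_rep G (representative \<alpha>) ?V) / ?n ^ r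
         * (real (irr_dim G \<beta>) * real (multiplicity_rep G (representative \<beta>) (tensor_rep (representative \<alpha>) \<eta>))
           / (real (irr_dim G \<alpha>) * ?n))
       = real (irr_dim G \<beta>) / ?n ^ Suc r * (real (multiplicity_rep G (representative \<alpha>) ?V)
       * real (multiplicity_rep G (representative \<beta>) (tensor_rep (representative \<alpha>) \<eta>)))"
      by (simp add: field_simps)
  qed
  also have "\<dots> = real (irr_dim G \<beta>) / ?n ^ Suc r * real (multiplicity_rep G (representative \<beta>) (tensor_rep ?V \<eta>))"
    unfolding multiplicity_tensor_decomposition[OF V \<eta>(1) fin representative_in_class(1)[OF Suc.prems]]
    by (simp add: sum_distrib_left)
  finally show ?case by simp
qed

lemma subgroup_sum_inv:
  assumes H: "subgroup H G"
  shows "(\<Sum>h\<in>H. f (inv h)) = (\<Sum>h\<in>H. f h)"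
  by (rule sum.reindex_bij_witness[of _ "\<lambda>g. inv g" "\<lambda>g. inv g"])
    (use subgroup.m_inv_closed[OF H] subgroup.mem_carrier[OF H] in auto)

text \<open>Burnside's interchange of summations for a permutation character twisted by \<open>\<rho>\<close>.\<close>

lemma multiplicity_permutation_character:
  assumes \<rho>: "irreducible_rep G \<rho>" and V: "representation G V" and X: "finite X"
    and ch: "\<And>g. g \<in> carrier G \<Longrightarrow> character V g = of_nat (card {x \<in> X. act g x = x})"
  shows "of_nat (card (carrier G) * multiplicity_rep G \<rho> V) =
    (\<Sum>x\<in>X. \<Sum>g | g \<in> carrier G \<and> act g x = x. character \<rho> (inv g))"
proof -
  have "of_nat (card (carrier G) * multiplicity_rep G \<rho> V) = (\<Sum>g\<in>carrier G. character \<rho> (inv g) * character V g)"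
    using order_pos by (auto simp: multiplicity_char_inner[OF \<rho> V] char_inner_def)
  also have "\<dots> = (\<Sum>g\<in>carrier G. \<Sum>x\<in>X. if act g x = x then character \<rho> (inv g) else 0)"
  proof (rule sum.cong[OF refl])
    fix g assume "g \<in> carrier G"
    then show "character \<rho> (inv g) * character V g = (\<Sum>x\<in>X. if act g x = x then character \<rho> (inv g) else 0)"
      using X by (simp add: ch sum.inter_filter[symmetric] mult.commute)
  qed
  also have "\<dots> = (\<Sum>x\<in>X. \<Sum>g\<in>carrier G. if act g x = x then character \<rho> (inv g) else 0)" by (rule sum.swap)
  also have "\<dots> = (\<Sum>x\<in>X. \<Sum>g | g \<in> carrier G \<and> act g x = x. character \<rho> (inv g))"
    by (simp add: sum.inter_filter[symmetric])
  finally show ?thesis .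
qed

text \<open>Divided by the order of \<open>H\<close> the sum is the inner product with the trivial character of \<open>H\<close>, hence the
multiplicity of the trivial representation in the restriction of \<open>\<rho>\<close> to \<open>H\<close>.\<close>

lemma subgroup_character_sum:
  assumes H: "subgroup H G" and \<rho>: "representation G \<rho>"
  shows "\<exists>m::nat. (\<Sum>h\<in>H. character \<rho> h) = of_nat m"
proof -
  let ?H = "G\<lparr>carrier := H\<rparr>"
  have "finite H" using finite_subset[OF subgroup.subset[OF H]] by simp
  interpret H: finite_group ?H
    using subgroup.subgroup_is_group[OF H is_group] \<open>finite H\<close>
    by (simp add: finite_group_def finite_group_axioms_def)
  have r: "representation ?H \<rho>"
    using \<rho> subgroup.mem_carrier[OF H] by (auto simp: representation_def rep_dim_def)
  have "(\<Sum>h\<in>H. character \<rho> h) = of_nat (card H) * H.char_inner (character (\<lambda>g. 1\<^sub>m 1)) (character \<rho>)"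
    using H.order_pos by (simp add: H.char_inner_def) (simp add: character_def)
  also have "\<dots> = of_nat (card H * multiplicity_rep ?H (\<lambda>g. 1\<^sub>m 1) \<rho>)"
    using H.multiplicity_char_inner[OF H.trivial_irreducible r] by simp
  finally show ?thesis by blast
qed

end

section \<open>Words that miss at most one letter\<close>

text \<open>The sum is written over the number \<open>j = n - i\<close> of undrawn coupons and completed by the terms \<open>-1\<close> for
\<open>j = 0\<close> and \<open>0\<close> for \<open>j = 1\<close>.\<close>

lemma coupon_formula_reindex:
  assumes n: "n \<ge> 1"
  shows "(\<Sum>i<n - 1. (-1) ^ (n - i) * real (n choose i) * (real n - real i - 1) * (real i / real n) ^ r)
    = 1 + (\<Sum>j\<le>n. (- 1) ^ j * (real j - 1) * (real (n choose j) * (1 - real j / real n) ^ r))"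
proof -
  let ?f = "\<lambda>i. (-1) ^ (n - i) * real (n choose i) * (real n - real i - 1) * (real i / real n) ^ r"
  have "(\<Sum>j\<le>n. (- 1) ^ j * (real j - 1) * (real (n choose j) * (1 - real j / real n) ^ r)) = (\<Sum>i\<le>n. ?f i)"
  proof (rule sum.reindex_bij_witness[of _ "\<lambda>i. n - i" "\<lambda>i. n - i"])
    fix j assume "j \<in> {..n}"
    then have j: "j \<le> n" by simp
    then have "1 - real j / real n = real (n - j) / real n" using n by (simp add: field_simps)
    then show "?f (n - j) = (- 1) ^ j * (real j - 1) * (real (n choose j) * (1 - real j / real n) ^ r)"
      using j by (simp add: binomial_symmetric[of j n])
  qed auto
  also have "\<dots> = ?f n + (?f (n - 1) + (\<Sum>i<n - 1. ?f i))"
  proof -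
    have "{..n} = {..<Suc (Suc (n - 1))}" using n by auto
    then have "(\<Sum>i\<le>n. ?f i) = (\<Sum>i<n - 1. ?f i) + ?f (n - 1) + ?f (Suc (n - 1))"
      by (simp only: sum.lessThan_Suc)
    then show ?thesis using n by simp
  qed
  also have "?f n = - 1" using n by simp
  also have "?f (n - 1) = 0" using n by simp
  finally show ?thesis by simp
qed

lemma sum_Pow_card:
  fixes f :: "nat \<Rightarrow> real"
  assumes "finite A"
  shows "(\<Sum>S\<in>Pow A. f (card S)) = (\<Sum>j\<le>card A. real (card A choose j) * f j)"
proof -
  have "(\<Sum>S\<in>Pow A. f (card S)) = (\<Sum>j\<le>card A. \<Sum>S | S \<in> Pow A \<and> card S = j. f (card S))"
    by (rule sum.group[symmetric]) (use assms in \<open>auto simp: card_mono\<close>)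
  also have "\<dots> = (\<Sum>j\<le>card A. real (card A choose j) * f j)"
  proof (rule sum.cong[OF refl])
    fix j
    have "(\<Sum>S | S \<in> Pow A \<and> card S = j. f (card S)) = (\<Sum>S | S \<subseteq> A \<and> card S = j. f j)"
      by (rule sum.cong) auto
    then show "(\<Sum>S | S \<in> Pow A \<and> card S = j. f (card S)) = real (card A choose j) * f j"
      using n_subsets[OF assms, of j] by simp
  qed
  finally show ?thesis .
qed

text \<open>The signed counts of subsets and of pointed subsets vanish unless the set is empty and a singleton,
respectively.\<close>

lemma at_most_one_inclusion_exclusion:
  assumes "finite A"
  shows "(\<Sum>S\<in>Pow A. (-1) ^ card S * (1 - real (card S))) = (if card A \<le> 1 then 1 else 0)"
proof -
  let ?m = "card A"
  have "(\<Sum>S\<in>Pow A. (-1) ^ card S * (1 - real (card S)))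
      = (\<Sum>j\<le>?m. real (?m choose j) * ((-1) ^ j * (1 - real j)))"
    by (rule sum_Pow_card[OF assms, of "\<lambda>j. (-1) ^ j * (1 - real j)"])
  also have "\<dots> = (\<Sum>j\<le>?m. (-1) ^ j * real (?m choose j)) - (\<Sum>j\<le>?m. (-1) ^ j * real j * real (?m choose j))"
    by (simp add: sum_subtractf[symmetric] algebra_simps)
  also have "\<dots> = (if ?m \<le> 1 then 1 else 0)"
  proof -
    consider "?m = 0" | "?m = 1" | "?m \<ge> 2" by linarith
    then show ?thesis
    proof cases
      case 3
      then show ?thesis
        using choose_alternating_sum[of ?m, where 'a=real] choose_alternating_linear_sum[of ?m, where 'a=real] by simp
    qed simp_all
  qed
  finally show ?thesis .
qed

definition words :: "nat \<Rightarrow> nat \<Rightarrow> nat list set" where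
  "words n r = {w. set w \<subseteq> {1..n} \<and> length w = r}"

definition almost_complete_words :: "nat \<Rightarrow> nat \<Rightarrow> nat list set" where
  "almost_complete_words n r = {w \<in> words n r. card ({1..n} - set w) \<le> 1}"

lemma finite_words [simp]: "finite (words n r)"
  by (simp add: words_def finite_lists_length_eq)

lemma finite_almost_complete_words [simp]: "finite (almost_complete_words n r)"
  by (simp add: almost_complete_words_def)

text \<open>Apply inclusion and exclusion to the set of letters missing from each word, and count for each set
\<open>S\<close> the words that avoid it.\<close>

lemma card_almost_complete_words:
  "real (card (almost_complete_words n r)) =
    (\<Sum>j\<le>n. (-1) ^ j * (1 - real j) * (real (n choose j) * real (n - j) ^ r))"
proof -
  let ?c = "\<lambda>S :: nat set. (-1) ^ card S * (1 - real (card S))"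
  have "real (card (almost_complete_words n r)) = (\<Sum>w\<in>words n r. if card ({1..n} - set w) \<le> 1 then 1 else 0)"
    by (simp add: almost_complete_words_def sum.inter_filter[symmetric])
  also have "\<dots> = (\<Sum>w\<in>words n r. \<Sum>S\<in>Pow ({1..n} - set w). ?c S)"
    by (simp only: at_most_one_inclusion_exclusion[OF finite_Diff[OF finite_atLeastAtMost]])
  also have "\<dots> = (\<Sum>w\<in>words n r. \<Sum>S\<in>Pow {1..n}. if S \<inter> set w = {} then ?c S else 0)"
  proof (rule sum.cong[OF refl])
    fix w assume "w \<in> words n r"
    have "Pow ({1..n} - set w) = {S \<in> Pow {1..n}. S \<inter> set w = {}}" by auto
    then show "(\<Sum>S\<in>Pow ({1..n} - set w). ?c S) = (\<Sum>S\<in>Pow {1..n}. if S \<inter> set w = {} then ?c S else 0)"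
      by (simp only: sum.inter_filter[OF finite_Pow_iff[THEN iffD2, OF finite_atLeastAtMost]])
  qed
  also have "\<dots> = (\<Sum>S\<in>Pow {1..n}. \<Sum>w\<in>words n r. if S \<inter> set w = {} then ?c S else 0)" by (rule sum.swap)
  also have "\<dots> = (\<Sum>S\<in>Pow {1..n}. ?c S * real (n - card S) ^ r)"
  proof (rule sum.cong[OF refl])
    fix S assume S: "S \<in> Pow {1..n}"
    then have fS: "finite S" by (auto intro: finite_subset)
    have "{w \<in> words n r. S \<inter> set w = {}} = {w. set w \<subseteq> {1..n} - S \<and> length w = r}"
      by (auto simp: words_def)
    then have "card {w \<in> words n r. S \<inter> set w = {}} = (n - card S) ^ r"
      using S fS by (simp add: card_lists_length_eq card_Diff_subset)
    then show "(\<Sum>w\<in>words n r. if S \<inter> set w = {} then ?c S else 0) = ?c S * real (n - card S) ^ r"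
      by (simp add: sum.inter_filter[symmetric])
  qed
  also have "\<dots> = (\<Sum>j\<le>n. real (n choose j) * ((-1) ^ j * (1 - real j) * real (n - j) ^ r))"
    using sum_Pow_card[of "{1..n}" "\<lambda>j. (-1) ^ j * (1 - real j) * real (n - j) ^ r"] by simp
  finally show ?thesis by (simp add: mult_ac)
qed

lemma coupon_formula_words:
  assumes n: "n \<ge> 1"
  shows "(\<Sum>i<n - 1. (-1) ^ (n - i) * real (n choose i) * (real n - real i - 1) * (real i / real n) ^ r)
    = 1 - real (card (almost_complete_words n r)) / real n ^ r"
proof -
  have "(\<Sum>j\<le>n. (- 1) ^ j * (real j - 1) * (real (n choose j) * (1 - real j / real n) ^ r))
      = - (\<Sum>j\<le>n. (-1) ^ j * (1 - real j) * (real (n choose j) * real (n - j) ^ r)) / real n ^ r"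
    unfolding sum_negf[symmetric] sum_divide_distrib
  proof (rule sum.cong[OF refl])
    fix j assume "j \<in> {..n}"
    then have "1 - real j / real n = real (n - j) / real n" using n by (simp add: field_simps)
    then show "(- 1) ^ j * (real j - 1) * (real (n choose j) * (1 - real j / real n) ^ r)
        = - ((-1) ^ j * (1 - real j) * (real (n choose j) * real (n - j) ^ r)) / real n ^ r"
      by (simp add: power_divide) (simp add: algebra_simps diff_divide_distrib)
  qed
  then show ?thesis
    unfolding coupon_formula_reindex[OF n] card_almost_complete_words by simp
qed

section \<open>The symmetric group\<close>

text \<open>Composition with a transposition reverses every sign.\<close>

lemma sum_sign_permutations:
  assumes "finite A" "card A \<ge> 2"
  shows "(\<Sum>p | p permutes A. of_int (sign p) :: complex) = 0"
proof -
  from assms obtain a b where ab: "a \<in> A" "b \<in> A" "a \<noteq> b"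
    by (metis card_le_Suc0_iff_eq not_less_eq_eq numeral_2_eq_2)
  have t: "transpose a b permutes A" using ab by (simp add: permutes_swap_id)
  have "(\<Sum>p | p permutes A. of_int (sign p) :: complex) = (\<Sum>p | p permutes A. of_int (sign (transpose a b \<circ> p)))"
    by (rule setum_permutations_compose_left[OF t])
  also have "\<dots> = (\<Sum>p | p permutes A. - of_int (sign p))"
  proof (rule sum.cong[OF refl])
    fix p assume "p \<in> {p. p permutes A}"
    then have "permutation p" using assms(1) permutation_permutes by blast
    moreover have "permutation (transpose a b)" using assms(1) t permutation_permutes by blast
    ultimately show "of_int (sign (transpose a b \<circ> p)) = (- of_int (sign p) :: complex)"
      using ab by (simp add: sign_compose sign_swap_id)
  qed
  also have "\<dots> = - (\<Sum>p | p permutes A. of_int (sign p))" by (rule sum_negf)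
  finally have "(\<Sum>p | p permutes A. of_int (sign p) :: complex) = - (\<Sum>p | p permutes A. of_int (sign p))" .
  moreover have "z = 0" if "z = - z" for z :: complex
    using that by (simp add: complex_eq_iff)
  ultimately show ?thesis by blast
qed

lemma permutes_card_le_1:
  assumes "finite A" "card A \<le> 1"
  shows "{p. p permutes A} = {id}"
proof -
  consider "A = {}" | a where "A = {a}"
    using assms by (metis One_nat_def card_0_eq card_1_singletonE le_SucE le_zero_eq)
  then show ?thesis by cases (auto simp: permutes_empty permutes_sing)
qed

lemma finite_group_sym_group: "finite_group (sym_group n)"
proof -
  interpret group "sym_group n" by (rule sym_group_is_group)
  show ?thesis
    by unfold_locales (simp add: sym_group_carrier finite_permutations sym_group_def)
qed

lemma representation_defining_rep:
  shows "representation (sym_group n) (defining_rep n)" "rep_dim (sym_group n) (defining_rep n) = n"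
proof -
  interpret finite_group "sym_group n" by (rule finite_group_sym_group)
  have 1: "defining_rep n p \<in> carrier_mat n n" for p by (simp add: defining_rep_def)
  have 2: "defining_rep n \<one>\<^bsub>sym_group n\<^esub> = 1\<^sub>m n"
    by (rule eq_matI) (auto simp: defining_rep_def sym_group_def)
  have 3: "defining_rep n (p \<otimes>\<^bsub>sym_group n\<^esub> q) = defining_rep n p * defining_rep n q"
    if p: "p \<in> carrier (sym_group n)" and q: "q \<in> carrier (sym_group n)" for p q
  proof (rule eq_matI)
    fix i j assume "i < dim_row (defining_rep n p * defining_rep n q)" "j < dim_col (defining_rep n p * defining_rep n q)"
    then have ij: "i < n" "j < n" by (simp_all add: defining_rep_def)
    have "q permutes {1..n}" using q by (simp add: sym_group_def)
    then have "q (Suc j) \<in> {1..n}" using permutes_in_image[of q "{1..n}" "Suc j"] ij by simp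
    then obtain k where k: "q (Suc j) = Suc k" "k < n" by (cases "q (Suc j)") auto
    have "(defining_rep n p * defining_rep n q) $$ (i, j)
        = (\<Sum>l<n. if l = k then (if Suc i = p (Suc k) then 1 else 0) else 0)"
      unfolding mult_mat_entry[OF 1 1 ij]
      by (rule sum.cong) (use ij k in \<open>auto simp: defining_rep_def\<close>)
    then show "defining_rep n (p \<otimes>\<^bsub>sym_group n\<^esub> q) $$ (i, j) = (defining_rep n p * defining_rep n q) $$ (i, j)"
      using ij k by (simp add: defining_rep_def sym_group_def)
  qed (simp_all add: defining_rep_def)
  show "representation (sym_group n) (defining_rep n)" "rep_dim (sym_group n) (defining_rep n) = n"
    by (rule representationI[of "defining_rep n" n]; simp only: 1 2 3)+
qed

lemma character_defining_rep:
  "character (defining_rep n) p = of_nat (card {x \<in> {1..n}. p x = x})"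
proof -
  have "character (defining_rep n) p = (\<Sum>i<n. if p (Suc i) = Suc i then 1 else 0)"
    by (auto simp: character_def mtrace_def defining_rep_def intro!: sum.cong)
  also have "\<dots> = of_nat (card {i \<in> {..<n}. p (Suc i) = Suc i})"
    by (simp add: sum.inter_filter[symmetric])
  also have "card {i \<in> {..<n}. p (Suc i) = Suc i} = card {x \<in> {1..n}. p x = x}"
  proof (rule bij_betw_same_card[of Suc], rule bij_betwI[of _ _ _ "\<lambda>x. x - 1"])
  qed auto
  finally show ?thesis .
qed

definition sign_rep :: "(nat \<Rightarrow> nat) rep" where
  "sign_rep p = mat 1 1 (\<lambda>_. of_int (sign p))"

context
  fixes n :: nat
begin

interpretation finite_group "sym_group n" by (rule finite_group_sym_group)

lemma carrier_sym: "carrier (sym_group n) = {p. p permutes {1..n}}"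
  by (simp add: sym_group_def)

lemma sign_rep_irreducible: "irreducible_rep (sym_group n) sign_rep"
proof -
  have 1: "sign_rep p \<in> carrier_mat 1 1" for p by (simp add: sign_rep_def)
  have 3: "sign_rep (p \<otimes>\<^bsub>sym_group n\<^esub> q) = sign_rep p * sign_rep q"
    if p: "p \<in> carrier (sym_group n)" and q: "q \<in> carrier (sym_group n)" for p q
  proof -
    have "permutation p" "permutation q" using p q permutation_permutes by (auto simp: carrier_sym)
    then show ?thesis
      by (intro eq_matI) (auto simp: sign_rep_def sym_group_def sign_compose scalar_prod_def)
  qed
  have 2: "sign_rep \<one>\<^bsub>sym_group n\<^esub> = 1\<^sub>m 1"
    by (rule eq_matI) (auto simp: sign_rep_def sym_group_def sign_id)
  show ?thesis
    by (rule one_dim_irreducible; rule representationI[of sign_rep 1]; simp only: 1 2 3)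
qed

lemma character_sign_rep: "character sign_rep p = of_int (sign p)"
  by (simp add: character_def mtrace_def sign_rep_def)

lemma word_stabilizer:
  assumes "w \<in> words n r"
  shows "{p. p \<in> carrier (sym_group n) \<and> map p w = w} = {p. p permutes ({1..n} - set w)}"
proof -
  have "p permutes {1..n} \<and> (\<forall>x\<in>set w. p x = x) \<longleftrightarrow> p permutes ({1..n} - set w)" for p
  proof
    assume "p permutes {1..n} \<and> (\<forall>x\<in>set w. p x = x)"
    then have p: "p permutes {1..n}" "\<forall>x\<in>set w. p x = x" by auto
    from p(1) show "p permutes ({1..n} - set w)" by (rule permutes_superset) (use p(2) in auto)
  next
    assume p: "p permutes ({1..n} - set w)"
    have "p x = x" if "x \<in> set w" for x using permutes_not_in[OF p] that by simp
    then show "p permutes {1..n} \<and> (\<forall>x\<in>set w. p x = x)" using permutes_subset[OF p] by blast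
  qed
  moreover have "map p w = w \<longleftrightarrow> (\<forall>x\<in>set w. p x = x)" for p
    by (metis map_eq_conv map_ident)
  ultimately show ?thesis by (simp add: carrier_sym)
qed

lemma permutes_subgroup:
  assumes "A \<subseteq> {1..n}"
  shows "subgroup {p. p permutes A} (sym_group n)"
proof (rule subgroupI)
  show "{p. p permutes A} \<subseteq> carrier (sym_group n)"
    using permutes_subset[OF _ assms] by (auto simp: carrier_sym)
  show "{p. p permutes A} \<noteq> {}" using permutes_id by blast
  fix p q assume p: "p \<in> {p. p permutes A}" and q: "q \<in> {p. p permutes A}"
  then show "p \<otimes>\<^bsub>sym_group n\<^esub> q \<in> {p. p permutes A}"
    by (simp add: sym_group_def permutes_compose)
  have "p \<in> carrier (sym_group n)" using p permutes_subset[OF _ assms] by (auto simp: carrier_sym)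
  then have "inv\<^bsub>sym_group n\<^esub> p = inv' p" by (rule sym_group_inv_equality)
  then show "inv\<^bsub>sym_group n\<^esub> p \<in> {p. p permutes A}" using p by (simp add: permutes_inv)
qed

lemma character_tensor_power_defining:
  assumes "p \<in> carrier (sym_group n)"
  shows "character (tensor_power (defining_rep n) r) p = of_nat (card {w \<in> words n r. map p w = w})"
proof -
  have "{w \<in> words n r. map p w = w} = {w. set w \<subseteq> {x \<in> {1..n}. p x = x} \<and> length w = r}"
  proof -
    have "map p w = w \<longleftrightarrow> (\<forall>x\<in>set w. p x = x)" for w by (metis map_eq_conv map_ident)
    then show ?thesis by (auto simp: words_def)
  qed
  then show ?thesis
    using character_tensor_power[OF representation_defining_rep(1) assms]
    by (simp add: card_lists_length_eq character_defining_rep)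
qed

text \<open>The tensor power has the character of the permutation action on words, whose stabilizers are the
symmetric groups on the missing letters.\<close>

lemma multiplicity_words:
  assumes "irreducible_rep (sym_group n) \<rho>"
  shows "of_nat (fact n * multiplicity_rep (sym_group n) \<rho> (tensor_power (defining_rep n) r)) =
    (\<Sum>w\<in>words n r. \<Sum>p | p permutes ({1..n} - set w). character \<rho> p)"
proof -
  have "card (carrier (sym_group n)) = fact n"
    by (simp add: carrier_sym card_permutations)
  then have "of_nat (fact n * multiplicity_rep (sym_group n) \<rho> (tensor_power (defining_rep n) r))
     = (\<Sum>w\<in>words n r. \<Sum>p | p \<in> carrier (sym_group n) \<and> map p w = w. character \<rho> (inv\<^bsub>sym_group n\<^esub> p))"
    using multiplicity_permutation_character[OF assms representation_tensor_power[OF representation_defining_rep(1)]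
        finite_words character_tensor_power_defining, of r] by simp
  also have "\<dots> = (\<Sum>w\<in>words n r. \<Sum>p | p permutes ({1..n} - set w). character \<rho> p)"
  proof (rule sum.cong[OF refl])
    fix w assume w: "w \<in> words n r"
    show "(\<Sum>p | p \<in> carrier (sym_group n) \<and> map p w = w. character \<rho> (inv\<^bsub>sym_group n\<^esub> p))
        = (\<Sum>p | p permutes ({1..n} - set w). character \<rho> p)"
      unfolding word_stabilizer[OF w] by (intro subgroup_sum_inv permutes_subgroup) auto
  qed
  finally show ?thesis .
qed

text \<open>All words contribute natural numbers. Those missing at most one letter have a trivial stabilizer and
contribute the value of the character at the identity.\<close>

lemma multiplicity_lower_bound:
  assumes \<rho>: "irreducible_rep (sym_group n) \<rho>"
  shows "card (almost_complete_words n r) * rep_dim (sym_group n) \<rho>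
    \<le> fact n * multiplicity_rep (sym_group n) \<rho> (tensor_power (defining_rep n) r)"
proof -
  have "\<exists>k::nat. (\<Sum>p | p permutes ({1..n} - set w). character \<rho> p) = of_nat k" for w
    by (rule subgroup_character_sum[OF permutes_subgroup irr_rep[OF \<rho>]]) auto
  then obtain k :: "nat list \<Rightarrow> nat" where
    k: "\<And>w. (\<Sum>p | p permutes ({1..n} - set w). character \<rho> p) = of_nat (k w)" by metis
  have kd: "k w = rep_dim (sym_group n) \<rho>" if w: "w \<in> almost_complete_words n r" for w
  proof -
    have "(of_nat (k w) :: complex) = character \<rho> id"
      using w k[of w] permutes_card_le_1[of "{1..n} - set w"] by (simp add: almost_complete_words_def)
    also have "\<dots> = of_nat (rep_dim (sym_group n) \<rho>)"
      using character_one[OF irr_rep[OF \<rho>]] by (simp add: sym_group_def)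
    finally show ?thesis by (simp only: of_nat_eq_iff)
  qed
  have "of_nat (fact n * multiplicity_rep (sym_group n) \<rho> (tensor_power (defining_rep n) r))
      = (of_nat (\<Sum>w\<in>words n r. k w) :: complex)"
    unfolding multiplicity_words[OF \<rho>] by (simp only: k of_nat_sum)
  then have "fact n * multiplicity_rep (sym_group n) \<rho> (tensor_power (defining_rep n) r) = (\<Sum>w\<in>words n r. k w)"
    by (simp only: of_nat_eq_iff)
  also have "\<dots> \<ge> (\<Sum>w\<in>almost_complete_words n r. k w)"
    by (rule sum_mono2) (auto simp: almost_complete_words_def)
  also have "(\<Sum>w\<in>almost_complete_words n r. k w) = card (almost_complete_words n r) * rep_dim (sym_group n) \<rho>"
    by (simp add: kd)
  finally show ?thesis .
qed

text \<open>For the sign representation the bound \<open>multiplicity_lower_bound\<close> is an equality, since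
words missing two or more letters contribute \<open>0\<close>.\<close>

lemma multiplicity_sign:
  "fact n * multiplicity_rep (sym_group n) (representative (irr_class sign_rep)) (tensor_power (defining_rep n) r)
    = card (almost_complete_words n r)"
proof -
  note irr = representative_in_class(1)[OF irr_class_in_Irr[OF sign_rep_irreducible]]
  have "(\<Sum>p | p permutes ({1..n} - set w). character (representative (irr_class sign_rep)) p)
      = (if card ({1..n} - set w) \<le> 1 then 1 else 0)" for w
  proof -
    let ?A = "{1..n} - set w"
    have "(\<Sum>p | p permutes ?A. character (representative (irr_class sign_rep)) p) = (\<Sum>p | p permutes ?A. of_int (sign p))"
    proof (rule sum.cong[OF refl])
      fix p assume "p \<in> {p. p permutes ?A}"
      then have "p \<in> carrier (sym_group n)"
        using subgroup.mem_carrier[OF permutes_subgroup[of ?A]] by blast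
      then show "character (representative (irr_class sign_rep)) p = of_int (sign p)"
        using character_representative[OF sign_rep_irreducible] by (simp add: character_sign_rep)
    qed
    also have "\<dots> = (if card ?A \<le> 1 then 1 else 0)"
      using sum_sign_permutations[of ?A] permutes_card_le_1[of ?A] by (auto simp: sign_id)
    finally show ?thesis .
  qed
  then have "of_nat (fact n * multiplicity_rep (sym_group n) (representative (irr_class sign_rep)) (tensor_power (defining_rep n) r))
     = (\<Sum>w\<in>words n r. if card ({1..n} - set w) \<le> 1 then 1 else 0 :: complex)"
    unfolding multiplicity_words[OF irr] by simp
  also have "\<dots> = of_nat (card (almost_complete_words n r))"
    by (simp add: almost_complete_words_def sum.inter_filter[symmetric])
  finally show ?thesis by (simp only: of_nat_eq_iff)
qed

lemma irr_dim_sign: "irr_dim (sym_group n) (irr_class sign_rep) = 1"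
proof -
  have "(of_nat (irr_dim (sym_group n) (irr_class sign_rep)) :: complex) = character sign_rep \<one>\<^bsub>sym_group n\<^esub>"
    using character_representative_one[OF irr_class_in_Irr[OF sign_rep_irreducible]]
      character_representative[OF sign_rep_irreducible one_closed] by simp
  also have "\<dots> = of_nat 1" by (simp add: character_sign_rep sym_group_def sign_id)
  finally show ?thesis by (simp only: of_nat_eq_iff)
qed

text \<open>The word that lists all letters once shows that the lower bound is positive for tensor powers with
\<open>n\<close> factors.\<close>

lemma finite_Irr_sym_group: "finite (Irr (sym_group n))"
proof (rule finite_Irr[OF representation_tensor_power[OF representation_defining_rep(1), of n]])
  fix \<rho> assume \<rho>: "irreducible_rep (sym_group n) \<rho>"
  have "[1..<Suc n] \<in> almost_complete_words n n"
    by (auto simp: almost_complete_words_def words_def atLeastLessThanSuc_atLeastAtMost simp del: upt_Suc)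
  then have "card (almost_complete_words n n) > 0" by (auto simp: card_gt_0_iff)
  then have "0 < card (almost_complete_words n n) * rep_dim (sym_group n) \<rho>"
    using irr_dim_pos[OF \<rho>] by simp
  also have "\<dots> \<le> fact n * multiplicity_rep (sym_group n) \<rho> (tensor_power (defining_rep n) n)"
    by (rule multiplicity_lower_bound[OF \<rho>])
  finally show "0 < multiplicity_rep (sym_group n) \<rho> (tensor_power (defining_rep n) n)" by simp
qed

text \<open>At an irreducible representation of dimension \<open>d\<close> and multiplicity \<open>m\<close> the quotient of the two measures
is \<open>n! * m / (d * n ^ r)\<close>. The lower bound on \<open>n! * m / d\<close> does not depend on the representation, and
the sign representation attains it.\<close>

theorem sym_separation_words:
  assumes n: "n \<ge> 1"
  shows "sym_separation n r = 1 - real (card (almost_complete_words n r)) / real n ^ r"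
proof -
  let ?G = "sym_group n" and ?N = "real (card (almost_complete_words n r))"
  let ?K = "kernel_power (Irr ?G) (irr_kernel ?G (defining_rep n)) r (trivial_irr ?G)"
  let ?m = "\<lambda>\<alpha>. multiplicity_rep ?G (representative \<alpha>) (tensor_power (defining_rep n) r)"
  have card: "card (carrier ?G) = fact n" by (simp add: carrier_sym card_permutations)
  have ratio: "?K \<alpha> / plancherel ?G \<alpha> = real (fact n * ?m \<alpha>) / (real (irr_dim ?G \<alpha>) * real n ^ r)"
    if \<alpha>: "\<alpha> \<in> Irr ?G" for \<alpha>
  proof -
    have "?K \<alpha> = real (irr_dim ?G \<alpha>) * real (?m \<alpha>) / real n ^ r"
      using kernel_power_from_trivial[OF representation_defining_rep(1) _ finite_Irr_sym_group \<alpha>, of r] n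
      by (simp add: representation_defining_rep(2))
    then show ?thesis using irr_dim_positive[OF \<alpha>] n
      by (simp add: plancherel_def card field_simps power2_eq_square)
  qed
  have "Max ((\<lambda>\<alpha>. 1 - ?K \<alpha> / plancherel ?G \<alpha>) ` Irr ?G) = 1 - ?N / real n ^ r"
  proof (rule Max_eqI)
    show "finite ((\<lambda>\<alpha>. 1 - ?K \<alpha> / plancherel ?G \<alpha>) ` Irr ?G)" using finite_Irr_sym_group by simp
  next
    fix y assume "y \<in> (\<lambda>\<alpha>. 1 - ?K \<alpha> / plancherel ?G \<alpha>) ` Irr ?G"
    then obtain \<alpha> where \<alpha>: "\<alpha> \<in> Irr ?G" and y: "y = 1 - ?K \<alpha> / plancherel ?G \<alpha>" by blast
    have d: "real (irr_dim ?G \<alpha>) > 0" using irr_dim_positive[OF \<alpha>] by simp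
    have "card (almost_complete_words n r) * irr_dim ?G \<alpha> \<le> fact n * ?m \<alpha>"
      using multiplicity_lower_bound[OF representative_in_class(1)[OF \<alpha>], of r] by (simp add: irr_dim_def)
    then have "real (card (almost_complete_words n r) * irr_dim ?G \<alpha>) \<le> real (fact n * ?m \<alpha>)"
      by (simp only: of_nat_le_iff)
    then have "?N \<le> real (fact n * ?m \<alpha>) / real (irr_dim ?G \<alpha>)"
      using d by (simp add: pos_le_divide_eq)
    then have "?N / real n ^ r \<le> real (fact n * ?m \<alpha>) / real (irr_dim ?G \<alpha>) / real n ^ r"
      by (rule divide_right_mono) simp
    then show "y \<le> 1 - ?N / real n ^ r" unfolding y ratio[OF \<alpha>] by simp
  next
    have "1 - ?N / real n ^ r = 1 - ?K (irr_class sign_rep) / plancherel ?G (irr_class sign_rep)"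
      unfolding ratio[OF irr_class_in_Irr[OF sign_rep_irreducible]] multiplicity_sign irr_dim_sign by simp
    then show "1 - ?N / real n ^ r \<in> (\<lambda>\<alpha>. 1 - ?K \<alpha> / plancherel ?G \<alpha>) ` Irr ?G"
      using irr_class_in_Irr[OF sign_rep_irreducible] by blast
  qed
  then show ?thesis by (simp add: sym_separation_def separation_distance_def)
qed

end

section \<open>Asymptotics of the inclusion-exclusion sum\<close>

text \<open>The quotient on the right is the product of the factors \<open>1 - i / n\<close> for \<open>i < j\<close>, the probability that
\<open>j\<close> draws are distinct; each factor takes away at most \<open>i / n\<close>.\<close>

lemma binomial_lower_bound:
  assumes "n \<ge> 1"
  shows "1 - (real j)\<^sup>2 / real n \<le> fact j * real (n choose j) / real n ^ j"
proof (induction j)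
  case (Suc j)
  let ?p = "\<lambda>j. fact j * real (n choose j) / real n ^ j"
  have n: "real n > 0" using assms by simp
  show ?case
  proof (cases "j \<le> n")
    case True
    have "fact (Suc j) * (n choose Suc j) = (n - j) * (fact j * (n choose j))"
    proof -
      have "Suc j * (n choose Suc j) = (n - j) * (n choose j)"
        by (simp only: binomial_absorption binomial_absorb_comp)
      then have "fact j * (Suc j * (n choose Suc j)) = fact j * ((n - j) * (n choose j))" by simp
      then show ?thesis by (simp only: fact_Suc of_nat_id mult.assoc mult.left_commute)
    qed
    then have "real (fact (Suc j) * (n choose Suc j)) = real ((n - j) * (fact j * (n choose j)))" by simp
    then have "fact (Suc j) * real (n choose Suc j) = (real n - real j) * (fact j * real (n choose j))"
      using True by (simp only: of_nat_mult of_nat_diff of_nat_fact)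
    then have step: "?p (Suc j) = ?p j - ?p j * (real j / real n)"
      using n by (simp add: field_simps)
    have "fact j * (n choose j) \<le> n ^ j" using binomial_fact_pow[of n j] by (simp add: mult.commute)
    then have "real (fact j * (n choose j)) \<le> real (n ^ j)" by (simp only: of_nat_le_iff)
    then have "?p j \<le> 1" using n by (simp add: divide_le_eq)
    then have "?p j * (real j / real n) \<le> 1 * (real j / real n)"
      by (intro mult_right_mono) auto
    then have "?p (Suc j) \<ge> 1 - (real j)\<^sup>2 / real n - real j / real n" using Suc step by linarith
    also have "1 - (real j)\<^sup>2 / real n - real j / real n \<ge> 1 - (real (Suc j))\<^sup>2 / real n"
      using n by (simp add: field_simps power2_eq_square)
    finally show ?thesis .
  next
    case False
    then have "real n \<le> real (Suc j)" by simp
    also have "real (Suc j) \<le> (real (Suc j))\<^sup>2" by (simp add: power2_eq_square)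
    finally have "1 - (real (Suc j))\<^sup>2 / real n \<le> 0" using n by (simp add: field_simps)
    also have "0 \<le> ?p (Suc j)" by simp
    finally show ?thesis .
  qed
qed simp

text \<open>From \<open>1 + t \<le> exp t\<close> follows \<open>exp (- t) * (1 - t\<^sup>2) \<le> 1 - t\<close>. The power of \<open>1 - t\<^sup>2\<close> is
estimated by Bernoulli's inequality.\<close>

lemma one_minus_power_lower_bound:
  fixes t :: real
  assumes "0 \<le> t" "t \<le> 1"
  shows "exp (- t * real r) * (1 - real r * t\<^sup>2) \<le> (1 - t) ^ r"
proof -
  have "(1 + t) * exp (- t) \<le> 1"
  proof -
    have "(1 + t) * exp (- t) \<le> exp t * exp (- t)"
      by (rule mult_right_mono) (use exp_ge_add_one_self[of t] in auto)
    then show ?thesis by (simp flip: exp_add)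
  qed
  then have "(1 - t) * ((1 + t) * exp (- t)) \<le> (1 - t) * 1"
    by (rule mult_left_mono) (use assms in simp)
  then have "exp (- t) * (1 - t\<^sup>2) \<le> 1 - t"
    by (simp add: power2_eq_square algebra_simps)
  then have "(exp (- t) * (1 - t\<^sup>2)) ^ r \<le> (1 - t) ^ r"
    by (rule power_mono) (use assms in \<open>simp add: power_le_one\<close>)
  moreover have "1 + real r * (- t\<^sup>2) \<le> (1 + (- t\<^sup>2)) ^ r"
    by (rule Bernoulli_inequality) (use assms in \<open>simp add: power_le_one\<close>)
  then have "exp (- t) ^ r * (1 - real r * t\<^sup>2) \<le> exp (- t) ^ r * (1 - t\<^sup>2) ^ r"
    by (intro mult_left_mono) auto
  ultimately have "exp (- t) ^ r * (1 - real r * t\<^sup>2) \<le> (1 - t) ^ r"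
    unfolding power_mult_distrib by (rule order.trans[rotated])
  moreover have "exp (- t * real r) = exp (- t) ^ r"
    by (simp add: exp_of_nat_mult[symmetric] mult.commute)
  ultimately show ?thesis by simp
qed

text \<open>Both \<open>(n choose j) \<le> n ^ j / j!\<close> and \<open>1 - t \<le> exp (- t)\<close> err on the same side, so \<open>a \<le> b\<close>; the
quotient \<open>a / b\<close> is the product of two factors in the unit interval, each bounded below by one of
the preceding lemmas. Beyond \<open>j = n\<close> the term \<open>a\<close> vanishes and the error bound is at least \<open>b\<close>,
so the estimate holds along the whole exponential series.\<close>

lemma binomial_term_bounds:
  fixes n j r :: nat
  assumes n: "n \<ge> 1"
  defines "a \<equiv> real (n choose j) * (1 - real j / real n) ^ r"
    and "b \<equiv> (real n * exp (- real r / real n)) ^ j / fact j"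
  shows "\<bar>a - b\<bar> \<le> (1 / real n + real r / (real n)\<^sup>2) * (real j)\<^sup>2 * b"
proof -
  have npos: "real n > 0" using n by simp
  have bpos: "b \<ge> 0" by (simp add: b_def)
  have bound: "\<bar>a - b\<bar> \<le> (u + v) * b" if "a \<le> b" "(1 - (u + v)) * b \<le> a" for u v
    using that by (simp add: algebra_simps)
  have eq: "(1 / real n + real r / (real n)\<^sup>2) * (real j)\<^sup>2
      = (real j)\<^sup>2 / real n + real r * (real j / real n)\<^sup>2"
    by (simp add: power_divide algebra_simps)
  show ?thesis
  proof (cases "j \<le> n")
    case True
    define t where "t = real j / real n"
    have t: "0 \<le> t" "t \<le> 1" using True npos by (auto simp: t_def)
    define p where "p = fact j * real (n choose j) / real n ^ j"
    define q where "q = (1 - t) ^ r / exp (- t * real r)"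
    have b: "b = real n ^ j / fact j * exp (- t * real r)"
      by (simp add: b_def power_mult_distrib exp_of_nat_mult[symmetric] t_def)
    have a: "a = p * q * b"
      using npos by (simp add: a_def p_def q_def b t_def)
    have "fact j * (n choose j) \<le> n ^ j" using binomial_fact_pow[of n j] by (simp add: mult.commute)
    then have "real (fact j * (n choose j)) \<le> real (n ^ j)" by (simp only: of_nat_le_iff)
    then have p: "0 \<le> p" "p \<le> 1" "1 - (real j)\<^sup>2 / real n \<le> p"
      using npos binomial_lower_bound[OF n, of j] by (auto simp: divide_le_eq p_def)
    have "(1 - t) ^ r \<le> exp (- t) ^ r"
      by (rule power_mono) (use t exp_ge_add_one_self[of "- t"] in auto)
    then have "(1 - t) ^ r \<le> exp (- t * real r)" by (simp add: exp_of_nat_mult[symmetric] mult.commute)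
    then have q: "0 \<le> q" "q \<le> 1" "1 - real r * t\<^sup>2 \<le> q"
      using t one_minus_power_lower_bound[OF t, of r]
      by (auto simp: q_def divide_le_eq pos_le_divide_eq mult.commute)
    \<comment> \<open>The errors of the two factors add: \<open>(1 - p) * (1 - q) \<ge> 0\<close>.\<close>
    have "p * q \<le> 1" using p q by (simp add: mult_le_one)
    moreover have "p * q \<ge> p + q - 1"
      using mult_nonneg_nonneg[of "1 - p" "1 - q"] p q by (simp add: algebra_simps)
    ultimately have "a \<le> b" "(1 - ((real j)\<^sup>2 / real n + real r * t\<^sup>2)) * b \<le> a"
      using p q bpos unfolding a by (auto simp: mult_left_le_one_le intro!: mult_right_mono)
    from bound[OF this] show ?thesis by (simp add: eq t_def)
  next
    case False
    then have "a = 0" by (simp add: a_def)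
    have "real n \<le> real j" using False by simp
    also have "real j \<le> (real j)\<^sup>2" using False by (simp add: power2_eq_square)
    finally have "1 \<le> (real j)\<^sup>2 / real n" using npos by simp
    moreover have "0 \<le> real r * (real j / real n)\<^sup>2" by simp
    ultimately have "1 * b \<le> ((real j)\<^sup>2 / real n + real r * (real j / real n)\<^sup>2) * b"
      by (intro mult_right_mono bpos) linarith
    then show ?thesis using \<open>a = 0\<close> bpos by (simp add: eq)
  qed
qed

lemma alternating_exp_series:
  "(\<lambda>j. (- 1) ^ j * (real j - 1) * (y ^ j / fact j)) sums (- ((y + 1) * exp (- y)))"
proof -
  have e: "(\<lambda>j. (- y) ^ j / fact j) sums exp (- y)"
    using exp_converges[of "- y"] by (simp add: divide_inverse mult.commute)
  then have "(\<lambda>j. (- y) * ((- y) ^ j / fact j)) sums ((- y) * exp (- y))" by (rule sums_mult)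
  then have "(\<lambda>j. real (Suc j) * ((- y) ^ Suc j / fact (Suc j))) sums ((- y) * exp (- y))"
    by (rule sums_cong[THEN iffD1, rotated]) (simp add: divide_simps)
  then have "(\<lambda>j. real j * ((- y) ^ j / fact j)) sums ((- y) * exp (- y))"
    by (subst (asm) sums_Suc_iff) simp
  moreover have "- y * exp (- y) - exp (- y) = - ((y + 1) * exp (- y))" by (simp add: algebra_simps)
  ultimately
  have "(\<lambda>j. real j * ((- y) ^ j / fact j) - (- y) ^ j / fact j) sums (- ((y + 1) * exp (- y)))"
    using sums_diff[OF _ e] by metis
  moreover have "(\<lambda>j. real j * ((- y) ^ j / fact j) - (- y) ^ j / fact j)
      = (\<lambda>j. (- 1) ^ j * (real j - 1) * (y ^ j / fact j))"
    by (simp add: fun_eq_iff power_minus[of y] algebra_simps diff_divide_distrib)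
  ultimately show ?thesis by simp
qed

text \<open>The errors sum to at most the prefactor times an exponential series, in which the polynomial weight
\<open>(j + 1) * j\<^sup>2\<close> is absorbed by \<open>8 ^ j\<close>.\<close>

lemma coupon_tail_approx:
  fixes n r :: nat
  assumes n: "n \<ge> 1"
  defines "y \<equiv> real n * exp (- real r / real n)"
  shows "\<bar>(\<Sum>j\<le>n. (- 1) ^ j * (real j - 1) * (real (n choose j) * (1 - real j / real n) ^ r))
      + (y + 1) * exp (- y)\<bar> \<le> (1 / real n + real r / (real n)\<^sup>2) * exp (8 * y)"
proof -
  define a where "a j = real (n choose j) * (1 - real j / real n) ^ r" for j
  define d where "d = 1 / real n + real r / (real n)\<^sup>2"
  have ypos: "y \<ge> 0" and dpos: "d \<ge> 0" by (simp_all add: y_def d_def)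
  have "(\<lambda>j. (- 1) ^ j * (real j - 1) * a j) sums (\<Sum>j\<le>n. (- 1) ^ j * (real j - 1) * a j)"
    by (rule sums_finite) (auto simp: a_def)
  from sums_diff[OF this alternating_exp_series[of y]]
  have S: "(\<lambda>j. (- 1) ^ j * (real j - 1) * (a j - y ^ j / fact j)) sums
     ((\<Sum>j\<le>n. (- 1) ^ j * (real j - 1) * a j) + (y + 1) * exp (- y))"
    by (simp add: right_diff_distrib)
  have E: "(\<lambda>j. d * ((8 * y) ^ j / fact j)) sums (d * exp (8 * y))"
    using sums_mult[OF exp_converges[of "8 * y"], of d] by (simp add: divide_inverse mult.commute)
  have "norm ((- 1) ^ j * (real j - 1) * (a j - y ^ j / fact j)) \<le> d * ((8 * y) ^ j / fact j)" for j
  proof -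
    have pw: "real j + 1 \<le> 2 ^ j"
      by (induction j) auto
    have "norm ((- 1) ^ j * (real j - 1) * (a j - y ^ j / fact j)) = \<bar>real j - 1\<bar> * \<bar>a j - y ^ j / fact j\<bar>"
      by (simp add: abs_mult)
    also have "\<dots> \<le> (real j + 1) * (d * (real j)\<^sup>2 * (y ^ j / fact j))"
      using binomial_term_bounds[OF n, of j r] by (intro mult_mono) (auto simp: a_def d_def y_def)
    also have "\<dots> = ((real j + 1) * (real j * real j)) * (d * (y ^ j / fact j))"
      by (simp add: power2_eq_square)
    also have "\<dots> \<le> (2 ^ j * (2 ^ j * 2 ^ j)) * (d * (y ^ j / fact j))"
      using pw ypos dpos by (intro mult_right_mono mult_mono) auto
    also have "(2::real) ^ j * (2 ^ j * 2 ^ j) = 8 ^ j"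
      by (simp flip: power_mult_distrib)
    finally show ?thesis by (simp add: power_mult_distrib mult_ac)
  qed
  from norm_suminf_le[OF this sums_summable[OF E]] sums_unique[OF S] sums_unique[OF E]
  show ?thesis by (simp add: a_def d_def)
qed

text \<open>The function \<open>(t + 1) * exp (- t)\<close> is the tail probability of the gamma distribution with shape \<open>2\<close>.
Its derivative is \<open>- t * exp (- t)\<close>, which for nonnegative \<open>t\<close> has absolute
value at most \<open>1\<close>.\<close>

lemma gamma_tail_lipschitz:
  fixes x y :: real
  assumes "0 \<le> x" "x \<le> y"
  shows "\<bar>(y + 1) * exp (- y) - (x + 1) * exp (- x)\<bar> \<le> y - x"
proof (cases "x = y")
  case False
  with assms have "x < y" by simp
  have "((\<lambda>t. (t + 1) * exp (- t)) has_real_derivative (- (t * exp (- t)))) (at t)" for t :: real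
    by (auto intro!: derivative_eq_intros simp: algebra_simps)
  from MVT2[OF \<open>x < y\<close> this] obtain z where z: "x < z" "z < y"
    "(y + 1) * exp (- y) - (x + 1) * exp (- x) = (y - x) * (- (z * exp (- z)))" by blast
  have "z \<le> exp z" using exp_ge_add_one_self[of z] by linarith
  then have "z * exp (- z) \<le> exp z * exp (- z)" by (rule mult_right_mono) simp
  then have "z * exp (- z) \<le> 1" by (simp flip: exp_add)
  then have "(y - x) * (z * exp (- z)) \<le> (y - x) * 1"
    using z by (intro mult_left_mono) auto
  then show ?thesis using z assms by (simp add: abs_mult)
qed simp

text \<open>Rounding the number of steps down changes \<open>r / n\<close> by at most \<open>1 / n\<close>, so \<open>y = n * exp (- r / n)\<close> lies
between \<open>exp (- c)\<close> and \<open>exp (- c) * exp (1 / n)\<close>. In particular \<open>y\<close> stays bounded, and the error of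
\<open>coupon_tail_approx\<close> has the order of its prefactor, \<open>ln n / n\<close>.\<close>

lemma coupon_formula_asymptotics:
  fixes c :: real
  defines "F \<equiv> \<lambda>(n::nat) (r::nat).
    (\<Sum>i<n - 1. (-1) ^ (n - i) * real (n choose i) * (real n - real i - 1) * (real i / real n) ^ r)"
  shows "(\<lambda>n. F n (nat \<lfloor>real n * ln (real n) + c * real n\<rfloor>) - (1 - exp (- exp (- c)) * (1 + exp (- c))))
    \<in> O(\<lambda>n. ln (real n) / real n)"
proof (rule bigoI)
  define x where "x = exp (- c)"
  define C where "C = (2 + \<bar>c\<bar>) * exp (8 * (x * exp 1)) + 2 * x"
  have "eventually (\<lambda>n. ln (real n) \<ge> 1 + \<bar>c\<bar>) at_top"
    by (rule filterlim_at_top[THEN iffD1, rule_format])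
       (rule filterlim_compose[OF ln_at_top filterlim_real_sequentially])
  moreover have "eventually (\<lambda>n::nat. n \<ge> 1) at_top" by (rule eventually_ge_at_top)
  ultimately show "eventually (\<lambda>n. norm (F n (nat \<lfloor>real n * ln (real n) + c * real n\<rfloor>)
      - (1 - exp (- exp (- c)) * (1 + exp (- c)))) \<le> C * norm (ln (real n) / real n)) at_top"
  proof eventually_elim
    case (elim n)
    then have n: "n \<ge> 1" and npos: "real n > 0" and l1: "ln (real n) \<ge> 1" "ln (real n) + c \<ge> 0" by auto
    define L where "L = real n * ln (real n) + c * real n"
    define r where "r = nat \<lfloor>L\<rfloor>"
    define y where "y = real n * exp (- real r / real n)"
    have L: "L = real n * (ln (real n) + c)" by (simp add: L_def algebra_simps)
    then have "L \<ge> 0" using npos l1 by simp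
    then have "real r = of_int \<lfloor>L\<rfloor>" by (simp add: r_def)
    then have r: "real r \<le> L" "L - 1 \<le> real r" by linarith+
    have Ln: "L / real n = ln (real n) + c" using npos by (simp add: L)
    have "real r / real n \<le> L / real n" "(L - 1) / real n \<le> real r / real n"
      using r npos by (auto intro!: divide_right_mono)
    then have rn: "real r / real n \<le> ln (real n) + c" "ln (real n) + c - 1 / real n \<le> real r / real n"
      by (simp_all only: diff_divide_distrib Ln)
    have nx: "real n * exp (- (ln (real n) + c)) = x"
    proof -
      have "exp (- (ln (real n) + c)) = exp (- ln (real n)) * exp (- c)" by (simp flip: exp_add)
      moreover have "exp (- ln (real n)) = inverse (real n)" using npos by (simp add: exp_minus)
      ultimately show ?thesis using npos by (simp add: x_def)
    qed
    have "y \<ge> real n * exp (- (ln (real n) + c))"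
      unfolding y_def using rn npos by (intro mult_left_mono) auto
    then have xy: "x \<le> y" by (simp only: nx)
    have "y \<le> real n * exp (- (ln (real n) + c) + 1 / real n)"
      unfolding y_def using rn npos by (intro mult_left_mono) auto
    then have yx: "y \<le> x * exp (1 / real n)" by (simp only: exp_add mult.assoc[symmetric] nx)
    have xpos: "x > 0" by (simp add: x_def)
    have "exp (1 / real n) \<le> 1 + 1 / real n + (1 / real n)\<^sup>2" by (rule exp_bound) (use n in auto)
    also have "(1 / real n)\<^sup>2 \<le> 1 / real n" using n by (simp add: power2_eq_square field_simps)
    finally have "exp (1 / real n) \<le> 1 + 2 / real n" by simp
    then have "x * exp (1 / real n) \<le> x * (1 + 2 / real n)" using xpos by (intro mult_left_mono) auto
    with yx have yx2: "y - x \<le> 2 * x / real n" by (simp add: algebra_simps)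
    have "x * exp (1 / real n) \<le> x * exp 1" using n xpos by (intro mult_left_mono) auto
    with yx have y1: "y \<le> x * exp 1" by simp
    have d: "1 / real n + real r / (real n)\<^sup>2 \<le> (2 + \<bar>c\<bar>) * ln (real n) / real n"
    proof -
      have "1 + real r / real n \<le> 1 + ln (real n) + \<bar>c\<bar>" using rn by linarith
      also have "\<dots> \<le> (2 + \<bar>c\<bar>) * ln (real n)"
        using l1 mult_left_mono[of 1 "ln (real n)" "\<bar>c\<bar>"] by (simp add: algebra_simps)
      finally have "(1 + real r / real n) / real n \<le> (2 + \<bar>c\<bar>) * ln (real n) / real n"
        using npos by (intro divide_right_mono) auto
      then show ?thesis by (simp add: add_divide_distrib power2_eq_square)
    qed
    have "\<bar>F n r - (1 - (y + 1) * exp (- y))\<bar> \<le> (1 / real n + real r / (real n)\<^sup>2) * exp (8 * y)"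
      using coupon_tail_approx[OF n, of r] unfolding F_def coupon_formula_reindex[OF n] y_def
      by (simp add: algebra_simps)
    also have "\<dots> \<le> (2 + \<bar>c\<bar>) * ln (real n) / real n * exp (8 * (x * exp 1))"
      using d y1 l1 npos by (intro mult_mono) auto
    finally have "\<bar>F n r - (1 - (y + 1) * exp (- y))\<bar> \<le> (2 + \<bar>c\<bar>) * ln (real n) / real n * exp (8 * (x * exp 1))" .
    moreover have "\<bar>(y + 1) * exp (- y) - (x + 1) * exp (- x)\<bar> \<le> 2 * x / real n"
      using gamma_tail_lipschitz[of x y] xpos xy yx2 by linarith
    moreover have "2 * x / real n \<le> 2 * x * ln (real n) / real n"
      using xpos l1 npos by (intro divide_right_mono) auto
    ultimately have "\<bar>F n r - (1 - (x + 1) * exp (- x))\<bar>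
        \<le> (2 + \<bar>c\<bar>) * ln (real n) / real n * exp (8 * (x * exp 1)) + 2 * x * ln (real n) / real n"
      by linarith
    also have "\<dots> = C * (ln (real n) / real n)"
      by (simp add: C_def algebra_simps add_divide_distrib)
    finally show ?case using l1 npos
      by (simp add: r_def L_def x_def mult.commute add.commute)
  qed
qed

section \<open>The separation distance\<close>

theorem theorem3p5:
  shows "(\<forall>n::nat. n \<ge> 1 \<longrightarrow> (\<forall>r::nat.
            sym_separation n r =
              (\<Sum>i<n - 1. (-1) ^ (n - i) * real (n choose i) * (real n - real i - 1)
                            * (real i / real n) ^ r)))
       \<and> (\<forall>c::real.
            (\<lambda>n::nat. sym_separation n (nat \<lfloor>real n * ln (real n) + c * real n\<rfloor>)
                       - (1 - exp (- exp (- c)) * (1 + exp (- c))))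
            \<in> O(\<lambda>n. ln (real n) / real n))"
proof (intro conjI allI impI)
  show formula: "sym_separation n r = (\<Sum>i<n - 1. (-1) ^ (n - i) * real (n choose i) * (real n - real i - 1)
      * (real i / real n) ^ r)" if "n \<ge> 1" for n r
    using sym_separation_words[OF that] coupon_formula_words[OF that] by simp
  fix c :: real
  show "(\<lambda>n::nat. sym_separation n (nat \<lfloor>real n * ln (real n) + c * real n\<rfloor>)
      - (1 - exp (- exp (- c)) * (1 + exp (- c)))) \<in> O(\<lambda>n. ln (real n) / real n)"
  proof (rule landau_o.big.in_cong[THEN iffD2, OF _ coupon_formula_asymptotics[of c]])
    show "eventually (\<lambda>n. sym_separation n (nat \<lfloor>real n * ln (real n) + c * real n\<rfloor>)
      - (1 - exp (- exp (- c)) * (1 + exp (- c)))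
      = (\<Sum>i<n - 1. (-1) ^ (n - i) * real (n choose i) * (real n - real i - 1)
          * (real i / real n) ^ nat \<lfloor>real n * ln (real n) + c * real n\<rfloor>)
      - (1 - exp (- exp (- c)) * (1 + exp (- c)))) at_top"
      using eventually_ge_at_top[of 1] by eventually_elim (simp only: formula)
  qed
qed

end
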